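(* Let $p>3$ be a prime and $q=p^s$ with $s$ a positive integer. Let $h(x)=b_3x^3+b_1x+b_0 \in \mathbb{F}_q[x]$ with $b_3\neq 0$, and let $\beta_0\in \mathbb{F}_q$. Let $\gamma_1, \gamma_2$ denote the critical points of $h$ (the roots of $h'$ in $\overline{\mathbb{F}}_q$, counted with multiplicity), and for each $n\ge 0$ let $\beta_n\in\overline{\mathbb{F}}_q$ be a root of $h^n(x)-\beta_0$. Then the pair $(h,\beta_0)$ is dynamically irreducible over $\mathbb{F}_q$ if and only if both of the following hold: (1) $-3\,(h^{n+1}(\gamma_1)-\beta_0)(h^{n+1}(\gamma_2)-\beta_0)$ is a non-zero square in $\mathbb{F}_q$ for all $n\geq 0$; and (2) for all $n\ge 0$, for $\mu_n\in \mathbb{F}_q(\beta_n)^\times$ such that $$-4\left(\frac{b_1}{b_3}\right)^3-27\left(\frac{b_0-\beta_n}{b_3}\right)^2=81\mu_n^2,$$ the element $$\frac{1}{2}\left(-\left(\frac{b_0-\beta_n}{b_3}\right)+\mu_n\sqrt{-3}\right)$$ is not a cube in $\mathbb{F}_q(\sqrt{-3},\beta_n)$ (where, in the case $b_1=0$, the sign of $\mu_n$ is chosen so that this element is non-zero).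
   Context: $\mathbb{F}_q$ is the finite field with $q$ elements, $\overline{\mathbb{F}}_q$ an algebraic closure, and $\sqrt{-3}$ a fixed square root of $-3$ in $\overline{\mathbb{F}}_q$. For a polynomial $h$, $h^n$ denotes the $n$-fold composition of $h$ with itself, with $h^0(x)=x$. For a polynomial $h\in K[x]$ of degree at least $2$ over a field $K$ and $\beta\in K$, the pair $(h,\beta)$ is dynamically irreducible over $K$ if $h^n(x)-\beta$ is irreducible over $K$ for all positive integers $n$. *)

theory Defs
  imports "HOL-Algebra.Algebraic_Closure_Type" "HOL-Algebra.Generated_Fields"
    "HOL-Library.Cardinality"
begin

definition poly_iterate :: "'a::comm_semiring_1 poly \<Rightarrow> nat \<Rightarrow> 'a poly" where
  "poly_iterate h n = (pcompose h ^^ n) [:0, 1:]"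

definition dynamically_irreducible :: "'a::field poly \<Rightarrow> 'a \<Rightarrow> bool" where
  "dynamically_irreducible h \<beta> \<longleftrightarrow>
     (\<forall>n>0. Factorial_Ring.irreducible (poly_iterate h n - [:\<beta>:]))"

abbreviation to_ac_poly :: "'a::field poly \<Rightarrow> 'a alg_closure poly" where
  "to_ac_poly \<equiv> map_poly to_ac"

definition adjoin :: "'a::field alg_closure set \<Rightarrow> 'a alg_closure set" where
  "adjoin S = generate_field ring_of_type_algebra (range to_ac \<union> S)"

end

theory Submission
  imports Defs
begin

text \<open>
  Everything happens inside the algebraic closure with the \<open>q\<close>-power Frobenius map. A polynomial of
  degree \<open>d\<close> is irreducible iff the Frobenius orbit of one of its roots has exactly \<open>d\<close> elements, so
  the passage from \<open>h\<^sup>n - \<beta>\<^sub>0\<close> to the next iterate asks whether \<open>\<psi> = frob\<^sup>d\<close>, \<open>d = 3\<^sup>n\<close>, permutes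
  the three roots of the depressed cubic \<open>(h - \<beta>\<^sub>n) / b\<^sub>3\<close> cyclically. This is the case iff \<open>\<psi>\<close> fixes
  the nonzero square root \<open>\<delta>\<close> of the discriminant (an even permutation) and does not fix all roots.
  The product of the conjugates of the discriminant is, up to squares, the product over the critical
  points in condition (1). The element in condition (2) is the cube of a Lagrange resolvent, which
  lies in the field generated by \<open>\<surd>-3\<close> and \<open>\<beta>\<^sub>n\<close> if the roots are fixed, whereas \<open>\<psi>\<^sup>2\<close> multiplies it
  by a primitive cube root of unity if the roots are permuted cyclically.
\<close>

section \<open>The base field inside its algebraic closure\<close>

lemma finite_field_power_card:
  fixes a :: "'a::{field,finite}"
  shows "a ^ CARD('a) = a"
proof (cases "a = 0")
  case False
  let ?U = "UNIV - {0 :: 'a}"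
  \<comment> \<open>Multiplication by \<open>a\<close> permutes the nonzero elements and so
    preserves their product, which forces the corresponding power of \<open>a\<close> to be
    1.\<close>
  have "bij_betw ((*) a) ?U ?U"
    by (rule bij_betwI[where g = "\<lambda>x. x / a"]) (use False in auto)
  hence "(\<Prod>x\<in>?U. a * x) = \<Prod>?U"
    using prod.reindex_bij_betw[of "(*) a" ?U ?U "\<lambda>x. x"] by simp
  hence "a ^ card ?U * \<Prod>?U = \<Prod>?U"
    by (simp add: prod.distrib)
  hence "a ^ card ?U = 1"
    by simp
  moreover have "CARD('a) = Suc (card ?U)"
    by (simp add: card_Suc_Diff1)
  ultimately show ?thesis
    by (metis power_Suc mult_1_right)
qed (simp add: zero_power)

lemma card_ge_2: "CARD('a::{field,finite}) \<ge> 2"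
  using card_mono[of UNIV "{0, 1 :: 'a}"] by simp

text \<open>The base field supplies \<open>CARD('a)\<close> roots of
  \<open>x ^ CARD('a) - x\<close>, and the degree leaves room for no others.\<close>

lemma range_to_ac: "range to_ac = {x :: 'a::{field,finite} alg_closure. x ^ CARD('a) = x}"
proof (rule card_subset_eq)
  let ?p = "monom 1 CARD('a) - [:0, 1:] :: 'a alg_closure poly"
  have "coeff ?p CARD('a) \<noteq> 0"
    using card_ge_2[where 'a = 'a] by (simp add: coeff_pCons split: nat.split)
  hence nz: "?p \<noteq> 0"
    by force
  have eq: "{x :: 'a alg_closure. x ^ CARD('a) = x} = {x. poly ?p x = 0}"
    by (simp add: poly_monom)
  show fin: "finite {x :: 'a alg_closure. x ^ CARD('a) = x}"
    unfolding eq using nz by (rule poly_roots_finite)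
  show sub: "range to_ac \<subseteq> {x :: 'a alg_closure. x ^ CARD('a) = x}"
    by (auto simp: finite_field_power_card simp flip: to_ac_power)
  have "card {x :: 'a alg_closure. x ^ CARD('a) = x} \<le> degree ?p"
    unfolding eq using nz by (rule card_poly_roots_bound)
  also have "\<dots> \<le> CARD('a)"
    by (intro degree_diff_le degree_monom_le) (use card_ge_2[where 'a = 'a] in simp)
  also have "CARD('a) = card (range (to_ac :: 'a \<Rightarrow> _))"
    by (simp add: card_image inj_to_ac)
  finally show "card (range (to_ac :: 'a \<Rightarrow> _)) = card {x :: 'a alg_closure. x ^ CARD('a) = x}"
    using card_mono[OF fin sub] by simp
qed

lemma power_card_minus_self:
  fixes x :: "'a::{field,finite} alg_closure"
  shows "x ^ CARD('a) - x = (\<Prod>a\<in>UNIV. x - to_ac (a :: 'a))"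
proof -
  have 1: "lead_coeff (\<Prod>a\<in>UNIV. [:- to_ac a, 1:]) = (1 :: 'a alg_closure)"
    by (simp only: lead_coeff_prod) simp
  have 2: "degree (\<Prod>a\<in>UNIV. [:- to_ac (a::'a), 1:]) = CARD('a)"
    by (subst degree_prod_eq_sum_degree) auto
  have 3: "degree (monom 1 CARD('a) - [:0, 1:] :: 'a alg_closure poly) = CARD('a)"
    using card_ge_2[where 'a = 'a]
    by (subst diff_conv_add_uminus, subst degree_add_eq_left) (simp_all add: degree_monom_eq)
  \<comment> \<open>Both sides are monic of degree \<open>CARD('a)\<close>, so agreement at that
    many points suffices.\<close>
  have "monom 1 CARD('a) - [:0, 1:] = (\<Prod>a\<in>UNIV. [:- to_ac (a::'a), 1:])"
  proof (rule poly_eqI_degree_lead_coeff[where n = "CARD('a)" and A = "range to_ac"])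
    show "coeff (monom 1 CARD('a) - [:0, 1:]) CARD('a)
        = coeff (\<Prod>a\<in>UNIV. [:- to_ac (a::'a), 1:]) CARD('a)"
      using 1 2 card_ge_2[where 'a = 'a] by (simp add: coeff_pCons split: nat.split)
    show "poly (monom 1 CARD('a) - [:0, 1:]) x = poly (\<Prod>a\<in>UNIV. [:- to_ac (a::'a), 1:]) x"
      if "x \<in> range to_ac" for x
      using that unfolding range_to_ac[where 'a = 'a]
      using that by (auto simp: poly_monom poly_prod)
  qed (simp_all add: 2 3 card_image inj_to_ac)
  from arg_cong[where f = "\<lambda>p. poly p x", OF this] show ?thesis
    by (simp add: poly_monom poly_prod)
qed

section \<open>The Frobenius map and its iterates as field homomorphisms\<close>

definition frob :: "'a::{field,finite} alg_closure \<Rightarrow> 'a alg_closure" where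
  "frob x = x ^ CARD('a)"

text \<open>
  Additivity needs no characteristic: \<open>x\<^sup>q - x\<close> is the product of the \<open>x - a\<close> over the base
  field, hence invariant under translation by elements of the base field, so that
  \<open>(x + y)\<^sup>q\<close> and \<open>x\<^sup>q + y\<^sup>q\<close>, as monic polynomials in \<open>x\<close>, agree on the base field.
\<close>
lemma frob_add: "frob (x + y) = frob x + frob y"
  for x y :: "'a::{field,finite} alg_closure"
proof -
  let ?q = "CARD('a)"
  have trans: "(to_ac a + y) ^ ?q = to_ac a + y ^ ?q" for a :: 'a
  proof -
    have "(to_ac a + y) ^ ?q - (to_ac a + y) = (\<Prod>b\<in>UNIV. y - to_ac (b - a))"
      by (subst power_card_minus_self) (simp add: algebra_simps)
    also have "\<dots> = (\<Prod>b\<in>UNIV. y - to_ac b)"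
      by (rule prod.reindex_bij_witness[of _ "\<lambda>b. b + a" "\<lambda>b. b - a"]) auto
    also have "\<dots> = y ^ ?q - y"
      by (rule power_card_minus_self[symmetric])
    finally show ?thesis
      by (simp add: algebra_simps)
  qed
  have deg: "degree (monom 1 ?q + [:y ^ ?q:]) = ?q"
    by (subst degree_add_eq_left) (simp_all add: degree_monom_eq)
  have "[:y, 1:] ^ ?q = monom 1 ?q + [:y ^ ?q:]"
  proof (rule poly_eqI_degree_lead_coeff[where n = ?q and A = "range to_ac"])
    show "coeff ([:y, 1:] ^ ?q) ?q = coeff (monom 1 ?q + [:y ^ ?q:]) ?q"
      using card_ge_2[where 'a = 'a]
      by (simp add: coeff_linear_power coeff_pCons split: nat.split)
    show "poly ([:y, 1:] ^ ?q) z = poly (monom 1 ?q + [:y ^ ?q:]) z" if "z \<in> range to_ac" for z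
      using that trans
      by (auto simp: poly_monom add.commute finite_field_power_card simp flip: to_ac_power)
  qed (simp_all add: deg degree_linear_power card_image inj_to_ac)
  from arg_cong[where f = "\<lambda>p. poly p x", OF this] show ?thesis
    by (simp add: poly_monom frob_def add.commute)
qed

lemma frob_mult: "frob (x * y) = frob x * frob y"
  by (simp add: frob_def power_mult_distrib)

lemma frob_0: "frob 0 = 0"
  by (simp add: frob_def)

lemma frob_to_ac: "frob (to_ac a) = to_ac a"
  by (simp add: frob_def finite_field_power_card flip: to_ac_power)

lemma frob_eq_self_iff: "frob x = x \<longleftrightarrow> x \<in> range to_ac"
  using range_to_ac by (auto simp: frob_def)

lemma frob_funpow_add: "(frob ^^ i) (x + y) = (frob ^^ i) x + (frob ^^ i) y"
  by (induction i) (simp_all add: frob_add)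

lemma frob_funpow_mult: "(frob ^^ i) (x * y) = (frob ^^ i) x * (frob ^^ i) y"
  by (induction i) (simp_all add: frob_mult)

lemma frob_funpow_to_ac [simp]: "(frob ^^ i) (to_ac a) = to_ac a"
  by (induction i) (simp_all add: frob_to_ac)

lemma frob_funpow_0 [simp]: "(frob ^^ i) 0 = 0"
  using frob_funpow_to_ac[of i 0] by simp

lemma frob_funpow_1 [simp]: "(frob ^^ i) 1 = 1"
  using frob_funpow_to_ac[of i 1] by simp

lemma frob_funpow_numeral [simp]: "(frob ^^ i) (numeral k) = numeral k"
  using frob_funpow_to_ac[of i "numeral k"] by simp

lemma frob_funpow_uminus: "(frob ^^ i) (- x) = - (frob ^^ i) x"
  using frob_funpow_add[of i x "- x"] by (simp add: eq_neg_iff_add_eq_0 add.commute)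

lemma frob_funpow_diff: "(frob ^^ i) (x - y) = (frob ^^ i) x - (frob ^^ i) y"
  using frob_funpow_add[of i x "- y"] by (simp add: frob_funpow_uminus)

lemma frob_funpow_power: "(frob ^^ i) (x ^ k) = (frob ^^ i) x ^ k"
  by (induction k) (simp_all add: frob_funpow_mult)

lemma frob_funpow_eq_0_iff [simp]: "(frob ^^ i) x = 0 \<longleftrightarrow> x = 0"
  by (induction i) (auto simp: frob_def)

lemma frob_funpow_inverse: "(frob ^^ i) (inverse x) = inverse ((frob ^^ i) x)"
proof (cases "x = 0")
  case False
  thus ?thesis
    using frob_funpow_mult[of i x "inverse x"] by (simp add: inverse_unique)
qed simp

lemma frob_funpow_divide: "(frob ^^ i) (x / y) = (frob ^^ i) x / (frob ^^ i) y"
  by (simp add: divide_inverse frob_funpow_mult frob_funpow_inverse)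

lemma frob_funpow_eq_iff: "(frob ^^ i) x = (frob ^^ i) y \<longleftrightarrow> x = y"
  using frob_funpow_eq_0_iff[of i "x - y"] by (simp add: frob_funpow_diff)

lemmas frob_funpow_hom = frob_funpow_add frob_funpow_mult frob_funpow_uminus frob_funpow_diff
  frob_funpow_power frob_funpow_divide

section \<open>Evaluation of base-field polynomials and Frobenius descent\<close>

lemma poly_to_ac_poly_add:
  "poly (to_ac_poly (f + g)) x = poly (to_ac_poly f) x + poly (to_ac_poly g) x"
  by (induction f g rule: poly_induct2) (simp_all add: map_poly_pCons algebra_simps)

lemma poly_to_ac_poly_diff:
  "poly (to_ac_poly (f - g)) x = poly (to_ac_poly f) x - poly (to_ac_poly g) x"
  using poly_to_ac_poly_add[of "f - g" g x] by simp

lemma poly_to_ac_poly_smult: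
  "poly (to_ac_poly (Polynomial.smult c f)) x = to_ac c * poly (to_ac_poly f) x"
  by (induction f) (simp_all add: map_poly_pCons algebra_simps)

lemma poly_to_ac_poly_mult:
  "poly (to_ac_poly (f * g)) x = poly (to_ac_poly f) x * poly (to_ac_poly g) x"
  by (induction f)
    (simp_all add: map_poly_pCons poly_to_ac_poly_add poly_to_ac_poly_smult algebra_simps)

lemma poly_to_ac_poly_pcompose:
  "poly (to_ac_poly (pcompose f g)) x = poly (to_ac_poly f) (poly (to_ac_poly g) x)"
  by (induction f)
    (simp_all add: map_poly_pCons pcompose_pCons poly_to_ac_poly_add poly_to_ac_poly_mult)

lemma degree_to_ac_poly [simp]: "degree (to_ac_poly f) = degree f"
  by (rule degree_map_poly) auto

lemma to_ac_poly_eq_0_iff [simp]: "to_ac_poly f = 0 \<longleftrightarrow> f = 0"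
  by (rule map_poly_eq_0_iff) auto

lemma frob_funpow_poly:
  "(frob ^^ i) (poly (to_ac_poly f) x) = poly (to_ac_poly f) ((frob ^^ i) x)"
  by (induction f) (simp_all add: map_poly_pCons frob_funpow_hom)

lemma frob_funpow_root:
  "poly (to_ac_poly f) x = 0 \<Longrightarrow> poly (to_ac_poly f) ((frob ^^ i) x) = 0"
  by (simp flip: frob_funpow_poly)

lemma poly_map_poly_frob: "poly (map_poly frob f) (frob x) = frob (poly f x)"
  by (induction f) (simp_all add: map_poly_pCons frob_0 frob_add frob_mult)

lemma degree_map_poly_frob: "degree (map_poly frob f) = degree f"
  by (rule degree_map_poly) (simp add: frob_def)

text \<open>Coefficients fixed by Frobenius lie in the base field. Polynomials built from full sets
  of conjugates are brought down to the base field this way.\<close>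

lemma map_poly_frob_fixed:
  assumes "map_poly frob f = f"
  obtains g where "f = to_ac_poly g"
proof -
  have "coeff f i \<in> range to_ac" for i
    using arg_cong[where f = "\<lambda>p. coeff p i", OF assms] frob_funpow_0[of 1]
    by (simp add: coeff_map_poly frob_eq_self_iff)
  hence "f = to_ac_poly (map_poly of_ac f)"
    by (intro poly_eqI) (simp add: coeff_map_poly to_ac_of_ac)
  thus ?thesis
    by (rule that)
qed

section \<open>Frobenius period, conjugates and irreducibility\<close>

lemma frob_periodic: "\<exists>d>0. (frob ^^ d) x = x"
proof -
  obtain f where f: "f \<noteq> 0" "poly (to_ac_poly f) x = 0"
    by (rule alg_closure_algebraic)
  \<comment> \<open>All iterates are roots of one nonzero polynomial over the base field, so two of
    them coincide; injectivity of Frobenius then cancels the smaller exponent.\<close>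
  have "range (\<lambda>i. (frob ^^ i) x) \<subseteq> {y. poly (to_ac_poly f) y = 0}"
    using frob_funpow_root[OF f(2)] by auto
  hence "finite (range (\<lambda>i. (frob ^^ i) x))"
    by (rule finite_subset) (rule poly_roots_finite, simp add: f(1))
  hence "\<not> inj (\<lambda>i. (frob ^^ i) x)"
    using finite_imageD by fastforce
  then obtain i j where "(frob ^^ i) x = (frob ^^ j) x" "i < j"
    using linorder_injI[of "\<lambda>i. (frob ^^ i) x"] by blast
  moreover from this have "(frob ^^ j) x = (frob ^^ i) ((frob ^^ (j - i)) x)"
    by (simp flip: comp_apply[of "frob ^^ i"] funpow_add)
  ultimately show ?thesis
    by (intro exI[of _ "j - i"]) (simp add: frob_funpow_eq_iff)
qed

text \<open>This is the degree of \<open>x\<close> over the base field, encoded as a period: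
  \<open>frob_deg_le_degree\<close> and \<open>ex_poly_of_frob_deg\<close> identify it with the
  least degree of a nonzero polynomial vanishing at \<open>x\<close>.\<close>

definition frob_deg :: "'a::{field,finite} alg_closure \<Rightarrow> nat" where
  "frob_deg x = (LEAST d. d > 0 \<and> (frob ^^ d) x = x)"

lemma frob_deg_pos: "frob_deg x > 0"
  and frob_funpow_frob_deg: "(frob ^^ frob_deg x) x = x"
  using LeastI_ex[OF frob_periodic[of x]] by (simp_all add: frob_deg_def)

lemma frob_funpow_eq_self_iff: "(frob ^^ m) x = x \<longleftrightarrow> frob_deg x dvd m"
proof
  assume "(frob ^^ m) x = x"
  hence "(frob ^^ (m mod frob_deg x)) x = x"
    by (simp add: funpow_mod_eq frob_funpow_frob_deg)
  moreover have "m mod frob_deg x < frob_deg x"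
    by (simp add: frob_deg_pos)
  ultimately have "m mod frob_deg x = 0"
    using not_less_Least[of "m mod frob_deg x" "\<lambda>d. d > 0 \<and> (frob ^^ d) x = x",
        folded frob_deg_def] by auto
  thus "frob_deg x dvd m"
    by auto
next
  assume "frob_deg x dvd m"
  thus "(frob ^^ m) x = x"
    using funpow_mod_eq[OF frob_funpow_frob_deg, of m x] by auto
qed

lemma inj_on_frob_orbit: "inj_on (\<lambda>i. (frob ^^ i) x) {..<frob_deg x}"
proof -
  have "i = j" if "i \<le> j" "j < frob_deg x" "(frob ^^ i) x = (frob ^^ j) x" for i j
  proof -
    have "(frob ^^ j) x = (frob ^^ i) ((frob ^^ (j - i)) x)"
      using that(1) by (simp flip: comp_apply[of "frob ^^ i"] funpow_add)
    hence "frob_deg x dvd j - i"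
      using that(3) by (simp add: frob_funpow_eq_iff flip: frob_funpow_eq_self_iff)
    thus ?thesis
      using that(1,2) by (auto dest: dvd_imp_le)
  qed
  thus ?thesis
    by (intro inj_onI) (metis lessThan_iff linorder_le_cases)
qed

text \<open>The conjugates of \<open>x\<close>. Listing them over a single period keeps the indexing
  injective, so products over conjugates become products over exponents.\<close>

definition frob_orbit :: "'a::{field,finite} alg_closure \<Rightarrow> 'a alg_closure set" where
  "frob_orbit x = (\<lambda>i. (frob ^^ i) x) ` {..<frob_deg x}"

lemma card_frob_orbit [simp]: "card (frob_orbit x) = frob_deg x"
  by (simp add: frob_orbit_def card_image inj_on_frob_orbit)

lemma finite_frob_orbit [simp]: "finite (frob_orbit x)"
  by (simp add: frob_orbit_def)

lemma frob_image_frob_orbit: "frob ` frob_orbit x = frob_orbit x"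
proof (rule card_subset_eq)
  have "(frob ^^ Suc i) x \<in> frob_orbit x" for i
  proof -
    have "(frob ^^ (Suc i mod frob_deg x)) x = (frob ^^ Suc i) x"
      by (rule funpow_mod_eq) (rule frob_funpow_frob_deg)
    thus ?thesis
      unfolding frob_orbit_def using frob_deg_pos[of x]
      by (metis imageI lessThan_iff mod_less_divisor)
  qed
  thus "frob ` frob_orbit x \<subseteq> frob_orbit x"
    unfolding frob_orbit_def by auto
  have "inj_on frob A" for A :: "'a alg_closure set"
    using frob_funpow_eq_iff[of 1] by (auto intro: inj_onI)
  thus "card (frob ` frob_orbit x) = card (frob_orbit x)"
    by (rule card_image)
qed simp

lemma poly_frob_orbit:
  "poly (to_ac_poly f) x = 0 \<Longrightarrow> y \<in> frob_orbit x \<Longrightarrow> poly (to_ac_poly f) y = 0"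
  by (auto simp: frob_orbit_def frob_funpow_root)

text \<open>Every conjugate of a root is again a root.\<close>

lemma frob_deg_le_degree:
  assumes "poly (to_ac_poly f) x = 0" "f \<noteq> 0"
  shows "frob_deg x \<le> degree f"
proof -
  have "card (frob_orbit x) \<le> card {y. poly (to_ac_poly f) y = 0}"
    using assms by (intro card_mono poly_roots_finite) (auto simp: poly_frob_orbit)
  also have "\<dots> \<le> degree (to_ac_poly f)"
    using assms(2) by (intro card_poly_roots_bound) simp
  finally show ?thesis
    by simp
qed

text \<open>The monic polynomial whose simple roots are the conjugates is invariant under Frobenius,
  which permutes them, and so descends to the base field.\<close>

lemma ex_poly_of_frob_deg:
  fixes x :: "'a::{field,finite} alg_closure"
  obtains m :: "'a poly" where "degree m = frob_deg x" "poly (to_ac_poly m) x = 0"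
proof -
  define M where "M = (\<Prod>y\<in>frob_orbit x. [:- y, 1:])"
  have deg: "degree M = frob_deg x"
    unfolding M_def by (subst degree_prod_eq_sum_degree) auto
  have lead: "lead_coeff M = 1"
    unfolding M_def by (simp only: lead_coeff_prod) simp
  have root: "poly M y = 0" if "y \<in> frob_orbit x" for y
    using that by (auto simp: M_def poly_prod)
  have "map_poly frob M = M"
  proof (rule poly_eqI_degree_lead_coeff[where n = "frob_deg x" and A = "frob_orbit x"])
    show "poly (map_poly frob M) y = poly M y" if "y \<in> frob_orbit x" for y
    proof -
      obtain z where "y = frob z" "z \<in> frob_orbit x"
        using \<open>y \<in> frob_orbit x\<close> frob_image_frob_orbit by blast
      thus ?thesis
        using frob_funpow_0[of 1] root that by (simp add: poly_map_poly_frob)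
    qed
    show "coeff (map_poly frob M) (frob_deg x) = coeff M (frob_deg x)"
      using lead deg frob_funpow_1[of 1] by (simp add: coeff_map_poly frob_def)
  qed (simp_all add: degree_map_poly_frob deg)
  then obtain m where "M = to_ac_poly m"
    by (rule map_poly_frob_fixed)
  moreover have "x \<in> frob_orbit x"
    unfolding frob_orbit_def using frob_deg_pos[of x] by (force intro: image_eqI[of _ _ 0])
  ultimately show ?thesis
    using that[of m] root deg by simp
qed

text \<open>A polynomial of degree \<open>frob_deg x\<close> vanishing at \<open>x\<close> divides
  \<open>f\<close>, since the remainder vanishes at \<open>x\<close> with too small a degree.
  Conversely, in any factorization the factor vanishing at \<open>x\<close> already uses up the
  whole degree.\<close>

lemma irreducible_iff_degree_eq_frob_deg:
  fixes f :: "'a::{field,finite} poly"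
  assumes "poly (to_ac_poly f) x = 0" "f \<noteq> 0"
  shows "Factorial_Ring.irreducible f \<longleftrightarrow> degree f = frob_deg x"
proof
  assume irr: "Factorial_Ring.irreducible f"
  obtain m where m: "degree m = frob_deg x" "poly (to_ac_poly m) x = 0"
    by (rule ex_poly_of_frob_deg)
  have "poly (to_ac_poly (f mod m)) x
      = poly (to_ac_poly f) x - poly (to_ac_poly (f div m)) x * poly (to_ac_poly m) x"
    by (simp flip: poly_to_ac_poly_mult poly_to_ac_poly_diff add: minus_div_mult_eq_mod)
  hence "poly (to_ac_poly (f mod m)) x = 0"
    using assms m by simp
  moreover have "degree (f mod m) < frob_deg x" if "f mod m \<noteq> 0"
    using that degree_mod_less[of m f] m(1) frob_deg_pos[of x] by (cases "m = 0") auto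
  ultimately have "f mod m = 0"
    using frob_deg_le_degree[of "f mod m" x] by force
  then obtain k where k: "f = m * k"
    by auto
  have "\<not> m dvd 1"
    using m(1) frob_deg_pos[of x] by (cases "m = 0") (simp_all add: is_unit_iff_degree)
  hence "k dvd 1"
    using irr k by (auto dest: irreducibleD)
  hence "degree k = 0"
    using k assms(2) by (simp add: is_unit_iff_degree)
  thus "degree f = frob_deg x"
    using k assms(2) m(1) by (auto simp: degree_mult_eq)
next
  assume deg: "degree f = frob_deg x"
  show "Factorial_Ring.irreducible f"
  proof (rule irreducibleI)
    show "\<not> f dvd 1"
      using deg frob_deg_pos[of x] assms(2) by (simp add: is_unit_iff_degree)
  next
    fix g k assume f: "f = g * k"
    have *: "b dvd 1" if "f = a * b" "poly (to_ac_poly a) x = 0" for a b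
    proof -
      have nz: "a \<noteq> 0" "b \<noteq> 0"
        using that(1) assms(2) by auto
      have "degree b = 0"
        using frob_deg_le_degree[OF that(2) nz(1)] deg nz by (simp add: that(1) degree_mult_eq)
      thus ?thesis
        using nz(2) by (simp add: is_unit_iff_degree)
    qed
    have "poly (to_ac_poly g) x = 0 \<or> poly (to_ac_poly k) x = 0"
      using assms(1) by (simp add: f poly_to_ac_poly_mult)
    thus "g dvd 1 \<or> k dvd 1"
      using * f by (metis mult.commute)
  qed (fact assms(2))
qed

text \<open>The conjugates are distinct roots and exhaust the degree.\<close>

lemma poly_eq_prod_frob_conjugates:
  fixes f :: "'a::{field,finite} poly"
  assumes "poly (to_ac_poly f) x = 0" "degree f = frob_deg x"
  shows "poly (to_ac_poly f) y = to_ac (lead_coeff f) * (\<Prod>i<frob_deg x. y - (frob ^^ i) x)"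
proof -
  let ?P = "\<Prod>z\<in>frob_orbit x. [:- z, 1:]"
  have deg: "degree ?P = frob_deg x"
    by (subst degree_prod_eq_sum_degree) auto
  have lead: "lead_coeff ?P = 1"
    by (simp only: lead_coeff_prod) simp
  have "to_ac_poly f = Polynomial.smult (to_ac (lead_coeff f)) ?P"
  proof (rule poly_eqI_degree_lead_coeff[where n = "frob_deg x" and A = "frob_orbit x"])
    show "poly (to_ac_poly f) z = poly (Polynomial.smult (to_ac (lead_coeff f)) ?P) z"
      if "z \<in> frob_orbit x" for z
      using that poly_frob_orbit[OF assms(1)] by (auto simp: poly_prod)
    show "coeff (to_ac_poly f) (frob_deg x)
        = coeff (Polynomial.smult (to_ac (lead_coeff f)) ?P) (frob_deg x)"
      using lead deg assms(2) by (simp add: coeff_map_poly)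
  qed (use assms(2) deg in \<open>auto intro: order.trans[OF degree_smult_le]\<close>)
  hence "poly (to_ac_poly f) y = to_ac (lead_coeff f) * (\<Prod>z\<in>frob_orbit x. y - z)"
    by (simp add: poly_prod)
  thus ?thesis
    by (simp add: frob_orbit_def prod.reindex[OF inj_on_frob_orbit])
qed

section \<open>Interpolation and generated fields\<close>

lemma ex_interpolating_poly:
  fixes y :: "'b::field \<Rightarrow> 'b"
  assumes "finite A"
  shows "\<exists>f. degree f \<le> card A - 1 \<and> (\<forall>a\<in>A. poly f a = y a)"
  using assms
proof (induction A rule: finite_induct)
  case empty
  show ?case
    by (intro exI[of _ 0]) simp
next
  case (insert a A)
  then obtain f where f: "degree f \<le> card A - 1" "\<And>b. b \<in> A \<Longrightarrow> poly f b = y b"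
    by blast
  let ?P = "\<Prod>b\<in>A. [:- b, 1:]"
  \<comment> \<open>Newton's correction: the added product vanishes at the old nodes and is scaled
    to repair the value at \<open>a\<close>.\<close>
  let ?g = "f + Polynomial.smult ((y a - poly f a) / (\<Prod>b\<in>A. a - b)) ?P"
  have "degree ?P = card A"
    by (subst degree_prod_eq_sum_degree) auto
  hence "degree ?g \<le> card (insert a A) - 1"
    using f(1) insert.hyps by (intro degree_add_le order.trans[OF degree_smult_le]) auto
  moreover have "poly ?g b = y b" if "b \<in> insert a A" for b
  proof (cases "b = a")
    case True
    have "(\<Prod>b\<in>A. a - b) \<noteq> 0"
      using insert.hyps by auto
    thus ?thesis
      by (simp add: True poly_prod)
  next
    case False
    hence "b \<in> A"
      using that by simp
    moreover from this have "(\<Prod>c\<in>A. b - c) = 0"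
      using insert.hyps by auto
    ultimately show ?thesis
      by (simp add: poly_prod f(2))
  qed
  ultimately show ?case
    by blast
qed

text \<open>The fixed field of \<open>frob ^^ frob_deg x\<close> is generated by \<open>x\<close>:
  interpolating the conjugates of \<open>z\<close> at the matching conjugates of \<open>x\<close>
  gives a polynomial invariant under Frobenius.\<close>

lemma frob_deg_fixed_eq_poly:
  fixes x z :: "'a::{field,finite} alg_closure"
  assumes "(frob ^^ frob_deg x) z = z"
  obtains g :: "'a poly" where "z = poly (to_ac_poly g) x"
proof -
  let ?d = "frob_deg x" and ?o = "\<lambda>i. (frob ^^ i) x"
  obtain f where deg: "degree f \<le> ?d - 1"
    and f: "\<And>y. y \<in> frob_orbit x \<Longrightarrow> poly f y = (frob ^^ inv_into {..<?d} ?o y) z"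
    using ex_interpolating_poly[of "frob_orbit x" "\<lambda>y. (frob ^^ inv_into {..<?d} ?o y) z"]
    by auto
  \<comment> \<open>Exponents may be reduced modulo \<open>?d\<close>, because
    \<open>frob ^^ ?d\<close> fixes \<open>z\<close> as well as \<open>x\<close>.\<close>
  have conj: "poly f (?o i) = (frob ^^ i) z" for i
  proof -
    have less: "i mod ?d < ?d"
      using frob_deg_pos[of x] by simp
    have "poly f (?o (i mod ?d)) = (frob ^^ inv_into {..<?d} ?o (?o (i mod ?d))) z"
      using less by (intro f) (auto simp: frob_orbit_def)
    also have "inv_into {..<?d} ?o (?o (i mod ?d)) = i mod ?d"
      using less by (intro inv_into_f_f[OF inj_on_frob_orbit]) simp
    finally show ?thesis
      by (simp add: funpow_mod_eq[OF frob_funpow_frob_deg] funpow_mod_eq[OF assms])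
  qed
  \<comment> \<open>Frobenius shifts both sequences of conjugates by one, so the two polynomials
    agree on the orbit, whose size exceeds their degrees.\<close>
  have "map_poly frob f = f"
  proof (rule poly_eqI_degree[where A = "frob_orbit x"])
    show "poly (map_poly frob f) y = poly f y" if "y \<in> frob_orbit x" for y
    proof -
      obtain u where "y = frob u" "u \<in> frob_orbit x"
        using \<open>y \<in> frob_orbit x\<close> frob_image_frob_orbit by blast
      then obtain i where y: "y = frob (?o i)"
        by (auto simp: frob_orbit_def)
      show ?thesis
        using conj[of i] conj[of "Suc i"] by (simp add: y poly_map_poly_frob)
    qed
  qed (use deg frob_deg_pos[of x] in \<open>simp_all add: degree_map_poly_frob\<close>)
  then obtain g where "f = to_ac_poly g"
    by (rule map_poly_frob_fixed)
  thus ?thesis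
    using conj[of 0] by (intro that[of g]) simp
qed

lemma to_ac_in_adjoin: "to_ac a \<in> adjoin S"
  unfolding adjoin_def by (rule generate_field.incl) simp

lemma in_adjoin: "x \<in> S \<Longrightarrow> x \<in> adjoin S"
  unfolding adjoin_def by (rule generate_field.incl) simp

lemma adjoin_add: "x \<in> adjoin S \<Longrightarrow> y \<in> adjoin S \<Longrightarrow> x + y \<in> adjoin S"
  using generate_field.eng_add[of x ring_of_type_algebra _ y]
  by (simp add: adjoin_def ring_of_type_algebra_def)

lemma adjoin_mult: "x \<in> adjoin S \<Longrightarrow> y \<in> adjoin S \<Longrightarrow> x * y \<in> adjoin S"
  using generate_field.eng_mult[of x ring_of_type_algebra _ y]
  by (simp add: adjoin_def ring_of_type_algebra_def)

lemma poly_in_adjoin: "x \<in> adjoin S \<Longrightarrow> poly (to_ac_poly g) x \<in> adjoin S"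
  using to_ac_in_adjoin[of 0 S]
  by (induction g) (simp_all add: map_poly_pCons adjoin_add adjoin_mult to_ac_in_adjoin)

lemma frob_deg_fixed_in_adjoin:
  assumes "(frob ^^ frob_deg x) z = z" "x \<in> adjoin S"
  shows "z \<in> adjoin S"
  using frob_deg_fixed_eq_poly[OF assms(1)] poly_in_adjoin[OF assms(2)] by metis

text \<open>The fixed points of a power of Frobenius form a field containing the base field, so it
  is enough to check generators.\<close>

lemma frob_fixed_adjoin:
  assumes "y \<in> adjoin S" "\<And>x. x \<in> S \<Longrightarrow> (frob ^^ m) x = x"
  shows "(frob ^^ m) y = y"
proof -
  let ?R = "ring_of_type_algebra :: 'a alg_closure ring"
  interpret R: field ?R
    by (rule field_from_type_algebra)
  have [simp]: "carrier ?R = UNIV" "\<zero>\<^bsub>?R\<^esub> = 0" "\<one>\<^bsub>?R\<^esub> = 1"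
      "u \<oplus>\<^bsub>?R\<^esub> v = u + v" "u \<otimes>\<^bsub>?R\<^esub> v = u * v" for u v
    by (simp_all add: ring_of_type_algebra_def)
  have uminus: "\<ominus>\<^bsub>?R\<^esub> u = - u" for u
    by (rule R.minus_equality) simp_all
  have inverse: "inv\<^bsub>?R\<^esub> u = inverse u" if "u \<noteq> 0" for u
    by (rule R.comm_inv_char) (use that in simp_all)
  from assms(1)[unfolded adjoin_def] show ?thesis
    by induction (auto simp: uminus inverse frob_funpow_hom frob_funpow_inverse assms(2))
qed

text \<open>
  With \<open>\<delta>\<^sup>2 = D\<close>, both statements say that the product of the conjugates of \<open>\<delta>\<close>, a square root
  of the norm, lies in the base field: Frobenius multiplies it by \<open>frob\<^sup>d \<delta> / \<delta>\<close>.
\<close>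
lemma norm_square_iff:
  fixes D \<delta> :: "'a::{field,finite} alg_closure"
  assumes "\<delta>\<^sup>2 = D" "D \<noteq> 0"
  shows "(\<exists>a. (\<Prod>i<d. (frob ^^ i) D) = to_ac (a\<^sup>2)) \<longleftrightarrow> (frob ^^ d) \<delta> = \<delta>"
proof -
  define M where "M = (\<Prod>i<d. (frob ^^ i) \<delta>)"
  have "\<delta> \<noteq> 0"
    using assms by auto
  hence "M \<noteq> 0"
    by (simp add: M_def)
  have M2: "M\<^sup>2 = (\<Prod>i<d. (frob ^^ i) D)"
    by (simp add: M_def prod_power_distrib frob_funpow_power flip: assms(1))
  have frob_M: "frob M = (\<Prod>i<d. (frob ^^ Suc i) \<delta>)"
    unfolding M_def by (induction d) (simp_all add: frob_mult frob_to_ac[of 1, simplified])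
  have "\<delta> * frob M = M * (frob ^^ d) \<delta>"
    unfolding frob_M unfolding M_def
    using prod.lessThan_Suc_shift[of "\<lambda>i. (frob ^^ i) \<delta>" d]
      prod.lessThan_Suc[of "\<lambda>i. (frob ^^ i) \<delta>" d] by simp
  hence iff: "(frob ^^ d) \<delta> = \<delta> \<longleftrightarrow> frob M = M"
    using \<open>M \<noteq> 0\<close> \<open>\<delta> \<noteq> 0\<close> by auto
  show ?thesis
  proof
    assume "\<exists>a. (\<Prod>i<d. (frob ^^ i) D) = to_ac (a\<^sup>2)"
    then obtain a where "M\<^sup>2 = (to_ac a)\<^sup>2"
      using M2 by auto
    hence "M = to_ac a \<or> M = to_ac (- a)"
      by (simp add: power2_eq_iff)
    thus "(frob ^^ d) \<delta> = \<delta>"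
      unfolding iff by (auto simp only: frob_to_ac)
  next
    assume "(frob ^^ d) \<delta> = \<delta>"
    then obtain a where "M = to_ac a"
      unfolding iff frob_eq_self_iff by auto
    thus "\<exists>a. (\<Prod>i<d. (frob ^^ i) D) = to_ac (a\<^sup>2)"
      by (auto simp flip: M2)
  qed
qed

section \<open>Depressed cubics, discriminants and Lagrange resolvents\<close>

lemma cubic_vieta:
  fixes A B :: "'b::field"
  assumes "r\<^sub>1 ^ 3 + A * r\<^sub>1 + B = 0" "r\<^sub>2 ^ 3 + A * r\<^sub>2 + B = 0" "r\<^sub>3 ^ 3 + A * r\<^sub>3 + B = 0"
    and "r\<^sub>1 \<noteq> r\<^sub>2" "r\<^sub>2 \<noteq> r\<^sub>3" "r\<^sub>3 \<noteq> r\<^sub>1"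
  shows "r\<^sub>3 = - r\<^sub>1 - r\<^sub>2" "A = r\<^sub>1 * r\<^sub>2 + r\<^sub>2 * r\<^sub>3 + r\<^sub>3 * r\<^sub>1" "B = - (r\<^sub>1 * r\<^sub>2 * r\<^sub>3)"
proof -
  \<comment> \<open>Differences of the root equations are divisible by differences of the roots;
    doing this twice isolates the sum of the roots.\<close>
  have "(r\<^sub>1 - r\<^sub>2) * (r\<^sub>1\<^sup>2 + r\<^sub>1 * r\<^sub>2 + r\<^sub>2\<^sup>2 + A) = 0" "(r\<^sub>2 - r\<^sub>3) * (r\<^sub>2\<^sup>2 + r\<^sub>2 * r\<^sub>3 + r\<^sub>3\<^sup>2 + A) = 0"
    using assms(1-3) by Groebner_Basis.algebra+
  hence 1: "r\<^sub>1\<^sup>2 + r\<^sub>1 * r\<^sub>2 + r\<^sub>2\<^sup>2 + A = 0" "r\<^sub>2\<^sup>2 + r\<^sub>2 * r\<^sub>3 + r\<^sub>3\<^sup>2 + A = 0"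
    using assms(4-5) by simp_all
  hence "(r\<^sub>3 - r\<^sub>1) * (r\<^sub>1 + r\<^sub>2 + r\<^sub>3) = 0"
    by Groebner_Basis.algebra
  hence 2: "r\<^sub>1 + r\<^sub>2 + r\<^sub>3 = 0"
    using assms(6) by simp
  show "r\<^sub>3 = - r\<^sub>1 - r\<^sub>2" "A = r\<^sub>1 * r\<^sub>2 + r\<^sub>2 * r\<^sub>3 + r\<^sub>3 * r\<^sub>1" "B = - (r\<^sub>1 * r\<^sub>2 * r\<^sub>3)"
    using 1 2 assms(1) by Groebner_Basis.algebra+
qed

lemma cubic_splits:
  fixes A B :: "'b::alg_closed_field"
  obtains r\<^sub>1 r\<^sub>2 r\<^sub>3 where "r\<^sub>3 = - r\<^sub>1 - r\<^sub>2" "A = r\<^sub>1 * r\<^sub>2 + r\<^sub>2 * r\<^sub>3 + r\<^sub>3 * r\<^sub>1" "B = - (r\<^sub>1 * r\<^sub>2 * r\<^sub>3)"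
proof -
  obtain r\<^sub>1 where "poly [:B, A, 0, 1:] r\<^sub>1 = 0"
    using alg_closed_imp_poly_has_root[of "[:B, A, 0, 1:]"] by auto
  \<comment> \<open>This quadratic is the cofactor of \<open>x - r\<^sub>1\<close> in
    \<open>x ^ 3 + A * x + B\<close>.\<close>
  moreover obtain r\<^sub>2 where "poly [:A + r\<^sub>1\<^sup>2, r\<^sub>1, 1:] r\<^sub>2 = 0"
    using alg_closed_imp_poly_has_root[of "[:A + r\<^sub>1\<^sup>2, r\<^sub>1, 1:]"] by auto
  ultimately have *: "B + r\<^sub>1 * (A + r\<^sub>1 * r\<^sub>1) = 0" "A + r\<^sub>1\<^sup>2 + r\<^sub>2 * (r\<^sub>1 + r\<^sub>2) = 0"
    by (simp_all add: algebra_simps)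
  show ?thesis
  proof (rule that)
    show "A = r\<^sub>1 * r\<^sub>2 + r\<^sub>2 * (- r\<^sub>1 - r\<^sub>2) + (- r\<^sub>1 - r\<^sub>2) * r\<^sub>1"
      using *(2) by Groebner_Basis.algebra
    show "B = - (r\<^sub>1 * r\<^sub>2 * (- r\<^sub>1 - r\<^sub>2))"
      using * by Groebner_Basis.algebra
  qed simp
qed

lemma cubic_discriminant:
  fixes r\<^sub>1 :: "'b::field"
  assumes "r\<^sub>3 = - r\<^sub>1 - r\<^sub>2" "A = r\<^sub>1 * r\<^sub>2 + r\<^sub>2 * r\<^sub>3 + r\<^sub>3 * r\<^sub>1" "B = - (r\<^sub>1 * r\<^sub>2 * r\<^sub>3)"
  shows "((r\<^sub>1 - r\<^sub>2) * (r\<^sub>2 - r\<^sub>3) * (r\<^sub>3 - r\<^sub>1))\<^sup>2 = - 4 * A ^ 3 - 27 * B\<^sup>2"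
  unfolding assms by Groebner_Basis.algebra

text \<open>Lets the single hypothesis \<open>6 \<noteq> 0\<close> exclude characteristics two and
  three together.\<close>

lemma six_eq_0_iff: "(6 :: 'b::field) = 0 \<longleftrightarrow> (2 :: 'b) = 0 \<or> (3 :: 'b) = 0"
proof -
  have "(6 :: 'b) = 2 * 3"
    by simp
  thus ?thesis
    by (simp only: mult_eq_0_iff)
qed

text \<open>
  The cube root is a third of the Lagrange resolvent \<open>r\<^sub>1 + \<omega> r\<^sub>2 + \<omega>\<^sup>2 r\<^sub>3\<close> for \<open>\<omega> = (w - 1) / 2\<close>,
  with \<open>r\<^sub>3\<close> eliminated.
\<close>
lemma lagrange_resolvent_cube:
  fixes r\<^sub>1 :: "'b::field"
  assumes "r\<^sub>3 = - r\<^sub>1 - r\<^sub>2" "B = - (r\<^sub>1 * r\<^sub>2 * r\<^sub>3)"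
    and "9 * \<mu> = - ((r\<^sub>1 - r\<^sub>2) * (r\<^sub>2 - r\<^sub>3) * (r\<^sub>3 - r\<^sub>1))"
    and "w\<^sup>2 = - 3" "(6 :: 'b) \<noteq> 0"
  shows "1 / 2 * (- B + \<mu> * w) = (((w + 3) * r\<^sub>1 + 2 * w * r\<^sub>2) / 6) ^ 3"
proof -
  have "108 * (- B + \<mu> * w) = ((w + 3) * r\<^sub>1 + 2 * w * r\<^sub>2) ^ 3"
    using assms(1-4) by Groebner_Basis.algebra
  moreover have "6 ^ 3 * (1 / 2 * (- B + \<mu> * w)) = 108 * (- B + \<mu> * w)"
    using assms(5) by (simp add: six_eq_0_iff field_simps)
  ultimately have "1 / 2 * (- B + \<mu> * w) = ((w + 3) * r\<^sub>1 + 2 * w * r\<^sub>2) ^ 3 / 6 ^ 3"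
    using assms(5) by (metis nonzero_mult_div_cancel_left power_eq_0_iff)
  thus ?thesis
    by (simp only: power_divide)
qed

text \<open>The prescribed action on the roots multiplies the resolvent \<open>U\<close> by the
  primitive cube root of unity \<open>(w - 1) / 2\<close>. On the other hand \<open>U / c\<close> is
  a cube root of unity, hence fixed like \<open>c\<close>, so \<open>U\<close> would be fixed too.
  Only \<open>U = 0\<close> allows both.\<close>

lemma lagrange_resolvent_not_fixed:
  fixes r\<^sub>1 c :: "'a::{field,finite} alg_closure"
  assumes "r\<^sub>3 = - r\<^sub>1 - r\<^sub>2" "(frob ^^ m) r\<^sub>1 = r\<^sub>3" "(frob ^^ m) r\<^sub>2 = r\<^sub>1"
    and "w\<^sup>2 = - 3" "(frob ^^ m) w = w" "(6 :: 'a alg_closure) \<noteq> 0"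
    and "(frob ^^ m) c = c" "c ^ 3 = (((w + 3) * r\<^sub>1 + 2 * w * r\<^sub>2) / 6) ^ 3"
  shows "c = 0"
proof (rule ccontr)
  assume "c \<noteq> 0"
  define U where "U = ((w + 3) * r\<^sub>1 + 2 * w * r\<^sub>2) / 6"
  have cU: "c ^ 3 = U ^ 3"
    by (simp only: assms(8) U_def)
  define t where "t = U / c"
  have U: "U = c * t"
    using \<open>c \<noteq> 0\<close> by (simp add: t_def)
  have U_nz: "U \<noteq> 0"
  proof
    assume "U = 0"
    hence "c ^ 3 = 0"
      using cU by simp
    thus False
      using \<open>c \<noteq> 0\<close> by simp
  qed
  have "t ^ 3 = 1"
    using U_nz by (simp add: t_def power_divide cU)
  \<comment> \<open>\<open>(2 * t + 1)\<^sup>2 + 3\<close> is four times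
    \<open>t\<^sup>2 + t + 1\<close>, so the cube roots of unity are expressed through the fixed
    element \<open>w\<close>.\<close>
  hence "(t - 1) * ((2 * t + 1)\<^sup>2 - w\<^sup>2) = 0"
    using assms(4) by Groebner_Basis.algebra
  hence "t = 1 \<or> 2 * t + 1 = w \<or> 2 * t + 1 = - w"
    by (auto simp: power2_eq_iff)
  hence "t = 1 \<or> t = (w - 1) / 2 \<or> t = (- w - 1) / 2"
    using assms(6) by (auto simp: six_eq_0_iff field_simps)
  hence "(frob ^^ m) t = t"
    by (elim disjE)
      (simp_all only: frob_funpow_hom assms(5) frob_funpow_1 frob_funpow_numeral)
  hence "(frob ^^ m) U = U"
    by (simp add: U frob_funpow_hom assms(7))
  hence "((w + 3) * r\<^sub>3 + 2 * w * r\<^sub>1) / 6 = U"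
    by (simp add: U_def frob_funpow_hom assms(2,3,5))
  hence "(w + 3) * r\<^sub>3 + 2 * w * r\<^sub>1 = (w + 3) * r\<^sub>1 + 2 * w * r\<^sub>2"
    unfolding U_def divide_cancel_right using assms(6) by blast
  \<comment> \<open>The two sides differ by \<open>(w - 3) / 2\<close> times the numerator of
    \<open>U\<close>, and \<open>(w - 3) * (w + 3) = - 12\<close>.\<close>
  hence "6 * ((w + 3) * r\<^sub>1 + 2 * w * r\<^sub>2) = 0"
    using assms(1,4) by Groebner_Basis.algebra
  hence "U = 0"
    unfolding U_def mult_eq_0_iff divide_eq_0_iff using assms(6) by blast
  thus False
    using U_nz by contradiction
qed

section \<open>Frobenius acting on the roots of a depressed cubic\<close>

lemma frob_funpow_sqrt_base:
  assumes "w\<^sup>2 = - numeral k"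
  shows "(frob ^^ (2 * d)) w = w"
proof -
  \<comment> \<open>Frobenius can only change the sign of \<open>w\<close>, and a second application
    restores it. Hence \<surd>-3 is handled with the doubled exponent.\<close>
  have "((frob ^^ d) w)\<^sup>2 = w\<^sup>2"
    by (simp add: assms frob_funpow_uminus flip: frob_funpow_power)
  hence "(frob ^^ d) w = w \<or> (frob ^^ d) w = - w"
    by (simp add: power2_eq_iff)
  moreover have "(frob ^^ (2 * d)) w = (frob ^^ d) ((frob ^^ d) w)"
    by (simp add: mult_2 funpow_add)
  ultimately show ?thesis
    by (auto simp: frob_funpow_uminus)
qed

text \<open>A transposition of the three distinct roots would negate the product of differences,
  which is nonzero and not its own negative; only the identity and the 3-cycles remain.\<close>

lemma frob_even_permutation:
  fixes r\<^sub>1 :: "'a::{field,finite} alg_closure"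
  assumes perm: "\<And>r. r \<in> {r\<^sub>1, r\<^sub>2, r\<^sub>3} \<Longrightarrow> (frob ^^ d) r \<in> {r\<^sub>1, r\<^sub>2, r\<^sub>3}"
    and fixed: "(frob ^^ d) ((r\<^sub>1 - r\<^sub>2) * (r\<^sub>2 - r\<^sub>3) * (r\<^sub>3 - r\<^sub>1)) = (r\<^sub>1 - r\<^sub>2) * (r\<^sub>2 - r\<^sub>3) * (r\<^sub>3 - r\<^sub>1)"
    and nz: "(r\<^sub>1 - r\<^sub>2) * (r\<^sub>2 - r\<^sub>3) * (r\<^sub>3 - r\<^sub>1) \<noteq> 0" "(2 :: 'a alg_closure) \<noteq> 0"
  shows "(frob ^^ d) r\<^sub>1 = r\<^sub>1 \<and> (frob ^^ d) r\<^sub>2 = r\<^sub>2 \<or>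
    (frob ^^ d) r\<^sub>1 \<noteq> r\<^sub>1 \<and> (frob ^^ (3 * d)) r\<^sub>1 = r\<^sub>1"
proof -
  define P :: "'a alg_closure \<Rightarrow> 'a alg_closure \<Rightarrow> 'a alg_closure \<Rightarrow> 'a alg_closure"
    where "P x y z = (x - y) * (y - z) * (z - x)" for x y z
  let ?F = "frob ^^ d"
  have "P r\<^sub>1 r\<^sub>2 r\<^sub>3 \<noteq> - P r\<^sub>1 r\<^sub>2 r\<^sub>3"
    using nz by (simp add: P_def eq_neg_iff_add_eq_0 flip: mult_2)
  moreover have "P r\<^sub>2 r\<^sub>1 r\<^sub>3 = - P r\<^sub>1 r\<^sub>2 r\<^sub>3" "P r\<^sub>1 r\<^sub>3 r\<^sub>2 = - P r\<^sub>1 r\<^sub>2 r\<^sub>3" "P r\<^sub>3 r\<^sub>2 r\<^sub>1 = - P r\<^sub>1 r\<^sub>2 r\<^sub>3"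
    unfolding P_def by Groebner_Basis.algebra+
  moreover have "P (?F r\<^sub>1) (?F r\<^sub>2) (?F r\<^sub>3) = P r\<^sub>1 r\<^sub>2 r\<^sub>3"
    using fixed by (simp add: P_def frob_funpow_hom)
  moreover have "?F r\<^sub>1 \<noteq> ?F r\<^sub>2" "?F r\<^sub>2 \<noteq> ?F r\<^sub>3" "?F r\<^sub>3 \<noteq> ?F r\<^sub>1" "r\<^sub>1 \<noteq> r\<^sub>2" "r\<^sub>1 \<noteq> r\<^sub>3"
    using nz(1) by (auto simp: frob_funpow_eq_iff)
  moreover have "(frob ^^ (3 * d)) r\<^sub>1 = ?F (?F (?F r\<^sub>1))"
    by (simp add: funpow_add numeral_3_eq_3)
  ultimately show ?thesis
    using perm[of r\<^sub>1] perm[of r\<^sub>2] perm[of r\<^sub>3] by auto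
qed

text \<open>Necessity of the two conditions. The iterates of \<open>r\<close> are three distinct
  roots, permuted cyclically and hence evenly. The square of the action is again a 3-cycle and
  multiplies the resolvent by a primitive cube root of unity, so a cube root \<open>c\<close> fixed
  by it can only be zero.\<close>

lemma cubic_frob_cycle_imp:
  fixes A B r w :: "'a::{field,finite} alg_closure"
  assumes w: "w\<^sup>2 = - 3" and six: "(6 :: 'a alg_closure) \<noteq> 0"
    and fixed: "(frob ^^ d) A = A" "(frob ^^ d) B = B"
    and root: "r ^ 3 + A * r + B = 0"
    and cycle: "(frob ^^ d) r \<noteq> r" "(frob ^^ (3 * d)) r = r"
  defines "D \<equiv> - 4 * A ^ 3 - 27 * B\<^sup>2"
  shows "D \<noteq> 0" "\<delta>\<^sup>2 = D \<Longrightarrow> (frob ^^ d) \<delta> = \<delta>"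
    "81 * \<mu>\<^sup>2 = D \<Longrightarrow> (frob ^^ (2 * d)) c = c \<Longrightarrow> 1 / 2 * (- B + \<mu> * w) = c ^ 3 \<Longrightarrow> c = 0"
proof -
  let ?F = "frob ^^ d"
  define r\<^sub>2 r\<^sub>3 where "r\<^sub>2 = ?F r" and "r\<^sub>3 = ?F r\<^sub>2"
  have F3: "?F r\<^sub>3 = r"
    using cycle(2) by (simp add: r\<^sub>2_def r\<^sub>3_def funpow_add numeral_3_eq_3)
  have F_root: "?F x ^ 3 + A * ?F x + B = 0" if "x ^ 3 + A * x + B = 0" for x
    using arg_cong[where f = ?F, OF that] by (simp add: frob_funpow_hom fixed)
  have "r\<^sub>2 ^ 3 + A * r\<^sub>2 + B = 0" "r\<^sub>3 ^ 3 + A * r\<^sub>3 + B = 0"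
    unfolding r\<^sub>3_def r\<^sub>2_def by (intro F_root root)+
  moreover have ne: "r \<noteq> r\<^sub>2" "r\<^sub>2 \<noteq> r\<^sub>3" "r\<^sub>3 \<noteq> r"
    using cycle(1) F3 frob_funpow_eq_iff by (auto simp: r\<^sub>2_def r\<^sub>3_def)
  ultimately have vieta: "r\<^sub>3 = - r - r\<^sub>2" "A = r * r\<^sub>2 + r\<^sub>2 * r\<^sub>3 + r\<^sub>3 * r" "B = - (r * r\<^sub>2 * r\<^sub>3)"
    using cubic_vieta[OF root, of r\<^sub>2 r\<^sub>3] by blast+
  define \<delta>' where "\<delta>' = (r - r\<^sub>2) * (r\<^sub>2 - r\<^sub>3) * (r\<^sub>3 - r)"
  have \<delta>': "\<delta>'\<^sup>2 = D"
    unfolding D_def \<delta>'_def by (rule cubic_discriminant[OF vieta])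
  show "D \<noteq> 0"
    using ne by (auto simp: \<delta>'_def simp flip: \<delta>')
  have "?F \<delta>' = (r\<^sub>2 - r\<^sub>3) * (r\<^sub>3 - r) * (r - r\<^sub>2)"
    by (simp add: \<delta>'_def frob_funpow_hom F3 flip: r\<^sub>2_def r\<^sub>3_def)
  hence F\<delta>': "?F \<delta>' = \<delta>'"
    by (simp add: \<delta>'_def ac_simps)
  show "?F \<delta> = \<delta>" if "\<delta>\<^sup>2 = D"
    using that F\<delta>' by (auto simp: power2_eq_iff frob_funpow_uminus simp flip: \<delta>')
  show "c = 0" if \<mu>: "81 * \<mu>\<^sup>2 = D" and c: "(frob ^^ (2 * d)) c = c" "1 / 2 * (- B + \<mu> * w) = c ^ 3"
  proof -
    have cyc2: "(frob ^^ (2 * d)) r = r\<^sub>3" "(frob ^^ (2 * d)) r\<^sub>2 = r"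
      using F3 by (simp_all add: mult_2 funpow_add flip: r\<^sub>2_def r\<^sub>3_def)
    \<comment> \<open>The pairs \<open>(\<mu>, w)\<close> and \<open>(- \<mu>, - w)\<close> give the
      same element, and one of them meets the sign convention
      \<open>9 * \<nu> = - \<delta>'\<close>.\<close>
    have "c = 0" if "v\<^sup>2 = - 3" "9 * \<nu> = - \<delta>'" "1 / 2 * (- B + \<nu> * v) = c ^ 3" for v \<nu>
    proof (rule lagrange_resolvent_not_fixed[OF vieta(1) cyc2 that(1) _ six c(1)])
      show "(frob ^^ (2 * d)) v = v"
        using that(1) by (rule frob_funpow_sqrt_base)
      show "c ^ 3 = (((v + 3) * r + 2 * v * r\<^sub>2) / 6) ^ 3"
        unfolding that(3)[symmetric]
        by (rule lagrange_resolvent_cube[OF vieta(1,3) that(2)[unfolded \<delta>'_def] that(1) six])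
    qed
    moreover have "(9 * \<mu>)\<^sup>2 = \<delta>'\<^sup>2"
      using \<mu> by (simp add: \<delta>' power_mult_distrib)
    hence "9 * \<mu> = - \<delta>' \<or> 9 * (- \<mu>) = - \<delta>'"
      unfolding power2_eq_iff by auto
    ultimately show ?thesis
      using w c(2) by (metis minus_mult_minus power2_minus)
  qed
qed

text \<open>Sufficiency of the two conditions. An even action is trivial or a 3-cycle, and a trivial
  one would put the resolvent into \<open>K\<close>, producing a forbidden cube. The set
  \<open>K\<close> stands for the field generated by \<surd>-3 and \<open>\<beta> n\<close>; only
  closure under forming resolvents of fixed elements is retained.\<close>

lemma cubic_frob_cycle_exists:
  fixes A B w \<delta> :: "'a::{field,finite} alg_closure"
  defines "D \<equiv> - 4 * A ^ 3 - 27 * B\<^sup>2"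
  assumes w: "w\<^sup>2 = - 3" and six: "(6 :: 'a alg_closure) \<noteq> 0"
    and fixed: "(frob ^^ d) A = A" "(frob ^^ d) B = B"
    and \<delta>: "D \<noteq> 0" "\<delta>\<^sup>2 = D" "(frob ^^ d) \<delta> = \<delta>"
    and closed: "\<And>a b v. (frob ^^ d) a = a \<Longrightarrow> (frob ^^ d) b = b \<Longrightarrow> v = w \<or> v = - w \<Longrightarrow>
      ((v + 3) * a + 2 * v * b) / 6 \<in> K"
    and no_cube: "\<And>\<mu> c. (frob ^^ d) \<mu> = \<mu> \<Longrightarrow> \<mu> \<noteq> 0 \<Longrightarrow> 81 * \<mu>\<^sup>2 = D \<Longrightarrow>
      1 / 2 * (- B + \<mu> * w) \<noteq> 0 \<Longrightarrow> c \<in> K \<Longrightarrow> 1 / 2 * (- B + \<mu> * w) \<noteq> c ^ 3"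
  shows "\<exists>r. r ^ 3 + A * r + B = 0 \<and> (frob ^^ d) r \<noteq> r \<and> (frob ^^ (3 * d)) r = r"
proof -
  let ?F = "frob ^^ d"
  obtain r\<^sub>1 r\<^sub>2 r\<^sub>3
    where vieta: "r\<^sub>3 = - r\<^sub>1 - r\<^sub>2" "A = r\<^sub>1 * r\<^sub>2 + r\<^sub>2 * r\<^sub>3 + r\<^sub>3 * r\<^sub>1" "B = - (r\<^sub>1 * r\<^sub>2 * r\<^sub>3)"
    by (rule cubic_splits)
  have roots: "x ^ 3 + A * x + B = 0 \<longleftrightarrow> x \<in> {r\<^sub>1, r\<^sub>2, r\<^sub>3}" for x
  proof -
    have "x ^ 3 + A * x + B = (x - r\<^sub>1) * (x - r\<^sub>2) * (x - r\<^sub>3)"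
      using vieta by Groebner_Basis.algebra
    thus ?thesis
      by auto
  qed
  have perm: "?F x \<in> {r\<^sub>1, r\<^sub>2, r\<^sub>3}" if "x \<in> {r\<^sub>1, r\<^sub>2, r\<^sub>3}" for x
  proof -
    have "x ^ 3 + A * x + B = 0"
      using that roots by blast
    from arg_cong[where f = ?F, OF this] show ?thesis
      by (simp only: frob_funpow_hom fixed frob_funpow_0 roots)
  qed
  define \<delta>' where "\<delta>' = (r\<^sub>1 - r\<^sub>2) * (r\<^sub>2 - r\<^sub>3) * (r\<^sub>3 - r\<^sub>1)"
  have \<delta>': "\<delta>'\<^sup>2 = D"
    unfolding D_def \<delta>'_def by (rule cubic_discriminant[OF vieta])
  hence "\<delta>' = \<delta> \<or> \<delta>' = - \<delta>"
    by (simp only: \<delta>(2)[symmetric] power2_eq_iff)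
  hence F\<delta>': "?F \<delta>' = \<delta>'"
    using \<delta>(3) by (auto simp: frob_funpow_uminus)
  have \<delta>'_nz: "\<delta>' \<noteq> 0"
    using \<delta>(1) \<delta>' by auto
  have two: "(2 :: 'a alg_closure) \<noteq> 0" and three: "(3 :: 'a alg_closure) \<noteq> 0"
    using six by (simp_all add: six_eq_0_iff)
  have nine: "(9 :: 'a alg_closure) \<noteq> 0"
  proof -
    have "(9 :: 'a alg_closure) = 3 * 3"
      by simp
    thus ?thesis
      using three by (simp only: mult_eq_0_iff simp_thms)
  qed
  \<comment> \<open>The factor -1/9 is dictated by \<open>lagrange_resolvent_cube\<close>; squaring
    it yields the constant 81 of condition (2).\<close>
  define \<mu> where "\<mu> = - \<delta>' / 9"
  have \<mu>: "9 * \<mu> = - \<delta>'" "\<mu> \<noteq> 0" "?F \<mu> = \<mu>"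
    using nine \<delta>'_nz by (simp_all add: \<mu>_def frob_funpow_hom F\<delta>')
  have "(9 * \<mu>)\<^sup>2 = \<delta>'\<^sup>2"
    by (simp add: \<mu>(1))
  hence \<mu>2: "81 * \<mu>\<^sup>2 = D"
    by (simp add: power_mult_distrib \<delta>')
  show ?thesis
  proof (cases "?F r\<^sub>1 = r\<^sub>1 \<and> ?F r\<^sub>2 = r\<^sub>2")
    case True
    have "w \<noteq> 0"
      using w three by auto
    \<comment> \<open>The elements for the two signs of \<open>\<mu>\<close> differ by
      \<open>\<mu> * w\<close>, so they cannot both vanish; \<open>no_cube\<close> speaks only of a
      nonzero one.\<close>
    hence "1 / 2 * (- B + \<mu> * w) \<noteq> 1 / 2 * (- B + - \<mu> * w)"
      using two \<mu>(2) by (simp add: eq_neg_iff_add_eq_0 flip: mult_2)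
    hence "1 / 2 * (- B + \<mu> * w) \<noteq> 0 \<or> 1 / 2 * (- B + - \<mu> * w) \<noteq> 0"
      by metis
    \<comment> \<open>A sign change of \<open>\<mu>\<close> is traded for one of \<open>w\<close>,
      so that \<open>\<mu>\<close> keeps its relation to the difference product.\<close>
    then obtain \<nu> v where \<nu>: "1 / 2 * (- B + \<nu> * w) \<noteq> 0" "?F \<nu> = \<nu>" "\<nu> \<noteq> 0" "81 * \<nu>\<^sup>2 = D"
      and v: "v = w \<or> v = - w" "\<nu> * w = \<mu> * v"
      using \<mu> \<mu>2 by (metis frob_funpow_uminus minus_mult_commute neg_equal_0_iff_equal power2_minus)
    have v2: "v\<^sup>2 = - 3"
      using v(1) w by auto
    have "1 / 2 * (- B + \<nu> * w) = (((v + 3) * r\<^sub>1 + 2 * v * r\<^sub>2) / 6) ^ 3"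
      unfolding v(2)
      by (rule lagrange_resolvent_cube[OF vieta(1,3) \<mu>(1)[unfolded \<delta>'_def] v2 six])
    moreover have "((v + 3) * r\<^sub>1 + 2 * v * r\<^sub>2) / 6 \<in> K"
      using True v(1) by (intro closed) simp_all
    ultimately show ?thesis
      using no_cube[OF \<nu>(2-4,1)] by metis
  next
    case False
    thus ?thesis
      using frob_even_permutation[of r\<^sub>1 r\<^sub>2 r\<^sub>3 d, OF perm F\<delta>'[unfolded \<delta>'_def]
          \<delta>'_nz[unfolded \<delta>'_def] two] roots[of r\<^sub>1] by blast
  qed
qed

section \<open>Norms of products of linear factors\<close>

lemma prod_frob_conjugates_eq_poly:
  assumes "poly (to_ac_poly f) x = 0" "degree f = frob_deg x"
    and "\<And>i. (frob ^^ i) D = to_ac k * (u - (frob ^^ i) x) * (v - (frob ^^ i) x)"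
  shows "(to_ac (lead_coeff f))\<^sup>2 * (\<Prod>i<frob_deg x. (frob ^^ i) D)
    = to_ac k ^ frob_deg x * poly (to_ac_poly f) u * poly (to_ac_poly f) v"
  by (simp add: assms(3) prod.distrib poly_eq_prod_frob_conjugates[OF assms(1,2)]
      power2_eq_square)

text \<open>The class of -3 modulo squares survives an odd power. The exponent will be the degree
  \<open>3 ^ n\<close>.\<close>

lemma odd_power_minus_3_times_square:
  fixes c :: "'b::comm_ring_1"
  assumes "odd d"
  shows "\<exists>s. (- 3 * c\<^sup>2) ^ d = - 3 * s\<^sup>2"
proof -
  obtain m where d: "d = 2 * m + 1"
    using assms by (rule oddE)
  have "(- 3 :: 'b) ^ d = - 3 * ((- 3) ^ m)\<^sup>2"
    by (simp only: d power_add power_one_right mult.commute flip: power_mult)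
  moreover have "(c\<^sup>2) ^ d = (c ^ d)\<^sup>2"
    by (simp only: mult.commute flip: power_mult)
  ultimately have "(- 3 * c\<^sup>2) ^ d = - 3 * ((- 3) ^ m * c ^ d)\<^sup>2"
    by (simp only: power_mult_distrib mult.assoc)
  thus ?thesis
    by blast
qed

section \<open>Iterates, characteristic and critical values\<close>

lemma degree_poly_iterate: "degree (poly_iterate h n) = degree h ^ n"
  for h :: "'b::{field} poly"
  by (induction n) (simp_all add: poly_iterate_def degree_pcompose)

lemma poly_to_ac_poly_iterate:
  "poly (to_ac_poly (poly_iterate h n)) x = (poly (to_ac_poly h) ^^ n) x"
  by (induction n) (simp_all add: poly_iterate_def poly_to_ac_poly_pcompose map_poly_pCons)

lemma six_neq_0:
  assumes "prime p" "p > 3" "CARD('a::{field,finite}) = p ^ s"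
  shows "(6 :: 'a) \<noteq> 0"
proof
  assume "(6 :: 'a) = 0"
  hence "CHAR('a) dvd 6"
    using of_nat_eq_0_iff_char_dvd[of 6, where 'a = 'a] by simp
  \<comment> \<open>Translation by 1 permutes the field, so comparing the two sums shows that the
    field size is zero in the field.\<close>
  have "(\<Sum>x\<in>UNIV. x + 1) = (\<Sum>x\<in>UNIV. x :: 'a)"
    by (rule sum.reindex_bij_witness[of _ "\<lambda>x. x - 1" "\<lambda>x. x + 1"]) auto
  hence "of_nat CARD('a) = (0 :: 'a)"
    by (simp add: sum.distrib)
  hence "CHAR('a) dvd p ^ s"
    by (simp only: of_nat_eq_0_iff_char_dvd assms(3))
  then obtain k where k: "CHAR('a) = p ^ k"
    using assms(1) divides_primepow_nat by blast
  have "k \<noteq> 0"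
    using k CHAR_not_1[where 'a = 'a] by (auto intro: ccontr)
  hence "p dvd CHAR('a)"
    by (simp add: k)
  hence "p dvd 2 * 3"
    using \<open>CHAR('a) dvd 6\<close> by (auto dest: dvd_trans)
  hence "p \<le> 3"
    unfolding prime_dvd_mult_iff[OF assms(1)] by (auto dest: dvd_imp_le)
  thus False
    using assms(2) by simp
qed

lemma cubic_critical_points:
  fixes \<gamma>\<^sub>1 \<gamma>\<^sub>2 :: "'a::field alg_closure"
  assumes "(6 :: 'a) \<noteq> 0" "b\<^sub>3 \<noteq> 0"
    and proots: "proots (to_ac_poly (pderiv [:b\<^sub>0, b\<^sub>1, 0, b\<^sub>3:])) = {#\<gamma>\<^sub>1, \<gamma>\<^sub>2#}"
  shows "\<gamma>\<^sub>2 = - \<gamma>\<^sub>1" "to_ac b\<^sub>1 = - 3 * to_ac b\<^sub>3 * \<gamma>\<^sub>1\<^sup>2"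
proof -
  let ?p = "to_ac_poly (pderiv [:b\<^sub>0, b\<^sub>1, 0, b\<^sub>3:])"
  have "(2 :: 'a) \<noteq> 0" "(3 :: 'a) \<noteq> 0"
    using assms(1) by (simp_all add: six_eq_0_iff)
  hence two: "(2 :: 'a alg_closure) \<noteq> 0" and three: "(3 :: 'a alg_closure) \<noteq> 0"
    using to_ac_eq_0_iff[of "2 :: 'a"] to_ac_eq_0_iff[of "3 :: 'a"] by simp_all
  have p: "?p = [:to_ac b\<^sub>1, 0, 3 * to_ac b\<^sub>3:]"
    by (simp add: pderiv_pCons map_poly_pCons)
  have "?p \<noteq> 0"
    using assms(2) three by (simp add: p)
  hence roots: "poly ?p x = 0 \<longleftrightarrow> x \<in> {\<gamma>\<^sub>1, \<gamma>\<^sub>2}" for x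
    using set_count_proots[of ?p] unfolding proots by auto
  have eval: "poly ?p x = to_ac b\<^sub>1 + 3 * to_ac b\<^sub>3 * x\<^sup>2" for x
    by (simp add: p power2_eq_square mult_ac)
  have \<gamma>\<^sub>1: "to_ac b\<^sub>1 + 3 * to_ac b\<^sub>3 * \<gamma>\<^sub>1\<^sup>2 = 0" and \<gamma>\<^sub>2: "to_ac b\<^sub>1 + 3 * to_ac b\<^sub>3 * \<gamma>\<^sub>2\<^sup>2 = 0"
    using roots[of \<gamma>\<^sub>1] roots[of \<gamma>\<^sub>2] by (simp_all add: eval)
  show "to_ac b\<^sub>1 = - 3 * to_ac b\<^sub>3 * \<gamma>\<^sub>1\<^sup>2"
    using \<gamma>\<^sub>1 by (simp add: eq_neg_iff_add_eq_0)
  \<comment> \<open>The derivative is an even polynomial, so the negative of a critical point is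
    critical. If the two coincide, the point is 0, which forces \<open>b\<^sub>1 = 0\<close> and a
    double critical point.\<close>
  have "- \<gamma>\<^sub>1 = \<gamma>\<^sub>1 \<or> - \<gamma>\<^sub>1 = \<gamma>\<^sub>2"
    using roots[of "- \<gamma>\<^sub>1"] \<gamma>\<^sub>1 by (auto simp: eval)
  moreover have "\<gamma>\<^sub>2 = - \<gamma>\<^sub>1" if "- \<gamma>\<^sub>1 = \<gamma>\<^sub>1"
  proof -
    have "2 * \<gamma>\<^sub>1 = 0"
      using that by (metis mult_2 add.left_inverse)
    hence "\<gamma>\<^sub>1 = 0"
      using two by simp
    thus ?thesis
      using \<gamma>\<^sub>1 \<gamma>\<^sub>2 assms(2) three by simp
  qed
  ultimately show "\<gamma>\<^sub>2 = - \<gamma>\<^sub>1"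
    by auto
qed

text \<open>The left side is the discriminant of the cubic \<open>(h - x) / b\<^sub>3\<close>,
  factored through the two critical values. The scalar is kept as -3 times a square because norms
  are later compared modulo squares.\<close>

lemma cubic_discriminant_critical_values:
  fixes \<gamma> x :: "'b::field"
  assumes "b\<^sub>1 = - 3 * b\<^sub>3 * \<gamma>\<^sup>2" "b\<^sub>3 \<noteq> 0"
  shows "- 4 * (b\<^sub>1 / b\<^sub>3) ^ 3 - 27 * ((b\<^sub>0 - x) / b\<^sub>3)\<^sup>2
    = - 3 * (3 / b\<^sub>3)\<^sup>2 * (poly [:b\<^sub>0, b\<^sub>1, 0, b\<^sub>3:] \<gamma> - x) * (poly [:b\<^sub>0, b\<^sub>1, 0, b\<^sub>3:] (- \<gamma>) - x)"
proof -
  define c where "c = (b\<^sub>0 - x) / b\<^sub>3"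
  have c: "b\<^sub>0 - x = b\<^sub>3 * c"
    using assms(2) by (simp add: c_def)
  have "poly [:b\<^sub>0, b\<^sub>1, 0, b\<^sub>3:] y - x = (b\<^sub>0 - x) + b\<^sub>1 * y + b\<^sub>3 * y ^ 3" for y
    by (simp add: algebra_simps power3_eq_cube)
  hence *: "poly [:b\<^sub>0, b\<^sub>1, 0, b\<^sub>3:] \<gamma> - x = b\<^sub>3 * (c - 2 * \<gamma> ^ 3)"
    "poly [:b\<^sub>0, b\<^sub>1, 0, b\<^sub>3:] (- \<gamma>) - x = b\<^sub>3 * (c + 2 * \<gamma> ^ 3)"
    by (simp_all add: c assms(1) algebra_simps power2_eq_square power3_eq_cube)
  have "b\<^sub>1 / b\<^sub>3 = - 3 * \<gamma>\<^sup>2"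
    using assms by simp
  hence "- 4 * (b\<^sub>1 / b\<^sub>3) ^ 3 - 27 * c\<^sup>2 = - 27 * (c - 2 * \<gamma> ^ 3) * (c + 2 * \<gamma> ^ 3)"
    by Groebner_Basis.algebra
  also have "\<dots> = - 3 * (3 / b\<^sub>3)\<^sup>2 * (b\<^sub>3 * (c - 2 * \<gamma> ^ 3)) * (b\<^sub>3 * (c + 2 * \<gamma> ^ 3))"
  proof -
    define k where "k = 3 / b\<^sub>3"
    have "b\<^sub>3 * k = 3"
      using assms(2) by (simp add: k_def)
    have "- 3 * k\<^sup>2 * (b\<^sub>3 * x) * (b\<^sub>3 * y) = - 3 * (b\<^sub>3 * k)\<^sup>2 * x * y" for x y
      by (simp only: power2_eq_square mult_ac)
    hence "- 3 * k\<^sup>2 * (b\<^sub>3 * x) * (b\<^sub>3 * y) = - 27 * x * y" for x y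
      by (simp add: \<open>b\<^sub>3 * k = 3\<close>)
    thus ?thesis
      unfolding k_def ..
  qed
  finally show ?thesis
    unfolding * c_def .
qed

text \<open>Taking the norm of \<open>D\<close> turns its two linear factors into values of
  \<open>f\<close>. In odd degree the scalar remains -3 up to squares, so the norm is the critical
  product times a nonzero square of the base field, and \<open>norm_square_iff\<close>
  applies.\<close>

lemma critical_values_square_iff:
  fixes D \<delta> u v x :: "'a::{field,finite} alg_closure"
  assumes "poly (to_ac_poly f) x = 0" "degree f = frob_deg x" "odd (frob_deg x)"
    and D: "\<And>i. (frob ^^ i) D = to_ac (- 3 * k\<^sup>2) * (u - (frob ^^ i) x) * (v - (frob ^^ i) x)"
    and "k \<noteq> 0" "(3 :: 'a) \<noteq> 0" "\<delta>\<^sup>2 = D"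
  shows "(\<exists>a. a \<noteq> 0 \<and> - 3 * poly (to_ac_poly f) u * poly (to_ac_poly f) v = to_ac (a\<^sup>2)) \<longleftrightarrow>
    D \<noteq> 0 \<and> (frob ^^ frob_deg x) \<delta> = \<delta>"
proof -
  define N where "N = (\<Prod>i<frob_deg x. (frob ^^ i) D)"
  define P where "P = - 3 * poly (to_ac_poly f) u * poly (to_ac_poly f) v"
  define l where "l = lead_coeff f"
  have "f \<noteq> 0"
    using assms(2) frob_deg_pos[of x] by auto
  hence l: "l \<noteq> 0"
    by (simp add: l_def)
  obtain s where s: "(- 3 * k\<^sup>2) ^ frob_deg x = - 3 * s\<^sup>2"
    using odd_power_minus_3_times_square[OF assms(3)] by blast
  have s_nz: "s \<noteq> 0"
  proof
    assume "s = 0"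
    hence "- 3 * k\<^sup>2 = 0"
      using s power_eq_0_iff[of "- 3 * k\<^sup>2" "frob_deg x"] by simp
    thus False
      using assms(5,6) by simp
  qed
  have "(to_ac l)\<^sup>2 * N = to_ac (- 3 * s\<^sup>2) * poly (to_ac_poly f) u * poly (to_ac_poly f) v"
    using prod_frob_conjugates_eq_poly[OF assms(1,2) D]
    unfolding N_def l_def by (simp only: s flip: to_ac_power)
  hence N: "N = (to_ac (s / l))\<^sup>2 * P"
    using l by (simp add: P_def field_simps)
  have N0: "N \<noteq> 0 \<longleftrightarrow> D \<noteq> 0"
    using frob_deg_pos[of x] by (auto simp: N_def)
  have "(\<exists>a. a \<noteq> 0 \<and> P = to_ac (a\<^sup>2)) \<longleftrightarrow> N \<noteq> 0 \<and> (\<exists>a. N = to_ac (a\<^sup>2))"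
  proof
    assume "\<exists>a. a \<noteq> 0 \<and> P = to_ac (a\<^sup>2)"
    then obtain a where a: "a \<noteq> 0" "P = to_ac (a\<^sup>2)"
      by blast
    hence "N = to_ac ((s / l * a)\<^sup>2)"
      by (simp add: N power_mult_distrib power_divide)
    moreover have "to_ac ((s / l * a)\<^sup>2) \<noteq> 0"
      using a(1) l s_nz by simp
    ultimately show "N \<noteq> 0 \<and> (\<exists>a. N = to_ac (a\<^sup>2))"
      by metis
  next
    assume "N \<noteq> 0 \<and> (\<exists>a. N = to_ac (a\<^sup>2))"
    then obtain a where a: "N \<noteq> 0" "N = to_ac (a\<^sup>2)"
      by blast
    hence "P = to_ac ((a * l / s)\<^sup>2)"
      using l s_nz unfolding N by (simp add: field_simps)
    moreover have "a * l / s \<noteq> 0"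
      using a l s_nz by auto
    ultimately show "\<exists>a. a \<noteq> 0 \<and> P = to_ac (a\<^sup>2)"
      by blast
  qed
  also have "\<dots> \<longleftrightarrow> D \<noteq> 0 \<and> (frob ^^ frob_deg x) \<delta> = \<delta>"
    unfolding N0 unfolding N_def using norm_square_iff[OF assms(7)] by blast
  finally show ?thesis
    by (simp add: P_def)
qed

section \<open>Tripling of the degree along the iterates\<close>

lemma frob_deg_preimage:
  assumes "poly (to_ac_poly h) r = x" "(frob ^^ frob_deg x) r \<noteq> r" "(frob ^^ (3 * frob_deg x)) r = r"
  shows "frob_deg r = 3 * frob_deg x"
proof -
  \<comment> \<open>Any period of \<open>r\<close> is one of its image under the base-field
    polynomial \<open>h\<close>. So \<open>frob_deg r\<close> lies between \<open>frob_deg x\<close>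
    and three times it in the divisibility order, and 3 is prime.\<close>
  have "frob_deg x dvd frob_deg r"
    using frob_funpow_poly[of "frob_deg r" h r] assms(1)
    by (simp add: frob_funpow_frob_deg flip: frob_funpow_eq_self_iff)
  then obtain k where k: "frob_deg r = frob_deg x * k"
    by (rule dvdE)
  have "frob_deg r dvd 3 * frob_deg x" "\<not> frob_deg r dvd frob_deg x"
    using assms(2,3) by (simp_all add: frob_funpow_eq_self_iff)
  hence "k dvd 3" "k \<noteq> 1"
    using frob_deg_pos[of x] by (auto simp: k mult.commute)
  moreover have "prime (3 :: nat)"
    by simp
  ultimately have "k = 3"
    by (auto simp: prime_nat_iff)
  thus ?thesis
    by (simp add: k)
qed

theorem proposition2:
  fixes p s :: nat
    and b\<^sub>0 b\<^sub>1 b\<^sub>3 \<beta>\<^sub>0 :: "'a::{field,finite}"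
    and h :: "'a poly"
    and sqrt_m3 \<gamma>\<^sub>1 \<gamma>\<^sub>2 :: "'a alg_closure"
    and \<beta> :: "nat \<Rightarrow> 'a alg_closure"
  assumes "prime p" and "p > 3" and "s > 0" and "CARD('a) = p ^ s"
    and "h = [:b\<^sub>0, b\<^sub>1, 0, b\<^sub>3:]" and "b\<^sub>3 \<noteq> 0"
    and "sqrt_m3\<^sup>2 = -3"
    and "proots (to_ac_poly (pderiv h)) = {#\<gamma>\<^sub>1, \<gamma>\<^sub>2#}"
    and "\<And>n. poly (to_ac_poly (poly_iterate h n - [:\<beta>\<^sub>0:])) (\<beta> n) = 0"
  shows "dynamically_irreducible h \<beta>\<^sub>0 \<longleftrightarrow>
    (\<forall>n. \<exists>a::'a. a \<noteq> 0 \<and>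
        -3 * (poly (to_ac_poly (poly_iterate h (n + 1))) \<gamma>\<^sub>1 - to_ac \<beta>\<^sub>0)
           * (poly (to_ac_poly (poly_iterate h (n + 1))) \<gamma>\<^sub>2 - to_ac \<beta>\<^sub>0) = to_ac (a\<^sup>2)) \<and>
    (\<forall>n. \<forall>\<mu> \<in> adjoin {\<beta> n} - {0}.
        -4 * to_ac (b\<^sub>1 / b\<^sub>3) ^ 3 - 27 * ((to_ac b\<^sub>0 - \<beta> n) / to_ac b\<^sub>3)\<^sup>2 = 81 * \<mu>\<^sup>2 \<longrightarrow>
        (b\<^sub>1 = 0 \<longrightarrow> 1 / 2 * (- ((to_ac b\<^sub>0 - \<beta> n) / to_ac b\<^sub>3) + \<mu> * sqrt_m3) \<noteq> 0) \<longrightarrow>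
        \<not> (\<exists>c \<in> adjoin {sqrt_m3, \<beta> n}.
             1 / 2 * (- ((to_ac b\<^sub>0 - \<beta> n) / to_ac b\<^sub>3) + \<mu> * sqrt_m3) = c ^ 3))"
    (is "_ \<longleftrightarrow> (\<forall>n. ?square n) \<and> (\<forall>n. ?no_cube n)")
proof -
  have six: "(6 :: 'a) \<noteq> 0"
    using assms(1,2,4) by (rule six_neq_0)
  hence six_ac: "(6 :: 'a alg_closure) \<noteq> 0"
    using to_ac_eq_0_iff[of "6 :: 'a"] by simp
  have two: "(2 :: 'a alg_closure) \<noteq> 0" and three: "(3 :: 'a) \<noteq> 0"
      "(3 :: 'a alg_closure) \<noteq> 0"
    using six six_ac by (simp_all add: six_eq_0_iff)
  have b\<^sub>3: "to_ac b\<^sub>3 \<noteq> 0"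
    using assms(6) by simp
  define H where "H = poly (to_ac_poly h)"
  have H: "H x = poly [:to_ac b\<^sub>0, to_ac b\<^sub>1, 0, to_ac b\<^sub>3:] x" for x
    by (simp add: H_def assms(5) map_poly_pCons)
  define f where "f n = poly_iterate h n - [:\<beta>\<^sub>0:]" for n
  have f: "poly (to_ac_poly (f n)) x = (H ^^ n) x - to_ac \<beta>\<^sub>0" for n x
    by (simp add: f_def H_def poly_to_ac_poly_diff poly_to_ac_poly_iterate map_poly_pCons)
  \<comment> \<open>A preimage under \<open>h\<close> of a root of \<open>f n\<close> is thus a root
    of \<open>f (Suc n)\<close>.\<close>
  have f_H: "poly (to_ac_poly (f n)) (H x) = poly (to_ac_poly (f (Suc n))) x" for n x
    by (simp only: f funpow_Suc_right o_apply)
  have "degree h = 3"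
    using assms(5,6) by simp
  hence deg_f: "degree (f n) = 3 ^ n" for n
    unfolding f_def by (simp add: degree_poly_iterate diff_conv_add_uminus degree_add_eq_left
        del: add_uminus_conv_diff)
  \<comment> \<open>The criterion holds at an arbitrary root, so the roots \<open>\<beta> n\<close>
    may be chosen independently and the step below may use any preimage of
    \<open>\<beta> n\<close>.\<close>
  have irr_f: "Factorial_Ring.irreducible (f n) \<longleftrightarrow> frob_deg x = 3 ^ n"
    if "poly (to_ac_poly (f n)) x = 0" for n x
  proof -
    have "f n \<noteq> 0"
      using deg_f[of n] by auto
    thus ?thesis
      using irreducible_iff_degree_eq_frob_deg[OF that] deg_f[of n] by auto
  qed
  have \<beta>: "poly (to_ac_poly (f n)) (\<beta> n) = 0" for n
    unfolding f_def by (rule assms(9))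
  \<comment> \<open>\<open>A\<close> and \<open>B x\<close> are the coefficients of the depressed
    cubic \<open>(h - x) / b\<^sub>3\<close>, and \<open>D x\<close> is its discriminant.\<close>
  define A where "A = to_ac (b\<^sub>1 / b\<^sub>3)"
  define B where "B x = (to_ac b\<^sub>0 - x) / to_ac b\<^sub>3" for x
  define D where "D x = - 4 * A ^ 3 - 27 * (B x)\<^sup>2" for x
  have cubic: "r ^ 3 + A * r + B x = 0 \<longleftrightarrow> H r = x" for r x
  proof -
    have "H r - x = to_ac b\<^sub>3 * (r ^ 3 + A * r + B x)"
      using assms(6) by (simp add: H A_def B_def field_simps power3_eq_cube)
    thus ?thesis
      using b\<^sub>3 by (metis eq_iff_diff_eq_0 mult_eq_0_iff)
  qed
  have frob_A: "(frob ^^ i) A = A" and frob_B: "(frob ^^ i) (B x) = B ((frob ^^ i) x)" for i x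
    by (simp_all add: A_def B_def frob_funpow_hom del: to_ac_divide)
  have frob_B_deg: "(frob ^^ frob_deg x) (B x) = B x" for x
    by (simp add: frob_B frob_funpow_frob_deg)
  note critical = cubic_critical_points[OF six assms(6) assms(8)[unfolded assms(5)]]
  have frob_D: "(frob ^^ i) (D x) = to_ac (- 3 * (3 / b\<^sub>3)\<^sup>2) * (H \<gamma>\<^sub>1 - (frob ^^ i) x)
      * (H \<gamma>\<^sub>2 - (frob ^^ i) x)" for i x
  proof -
    have "(frob ^^ i) (D x) = D ((frob ^^ i) x)"
      by (simp add: D_def frob_funpow_hom frob_A frob_B)
    thus ?thesis
      using cubic_discriminant_critical_values[OF critical(2) b\<^sub>3, of "to_ac b\<^sub>0" "(frob ^^ i) x"]
      by (simp add: D_def A_def B_def H critical(1))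
  qed
  have square_iff: "?square n \<longleftrightarrow> D (\<beta> n) \<noteq> 0 \<and> (frob ^^ frob_deg (\<beta> n)) \<delta> = \<delta>"
    if "Factorial_Ring.irreducible (f n)" "\<delta>\<^sup>2 = D (\<beta> n)" for n \<delta>
  proof -
    have d: "frob_deg (\<beta> n) = 3 ^ n"
      using irr_f[OF \<beta>] that(1) by blast
    \<comment> \<open>Splitting off the innermost \<open>h\<close> turns condition (1) at index
      \<open>n\<close> into values of \<open>f n\<close>, not of \<open>f (n + 1)\<close>, at the
      critical values; the relevant degree is \<open>3 ^ n\<close>.\<close>
    have "poly (to_ac_poly (poly_iterate h (n + 1))) x - to_ac \<beta>\<^sub>0 = poly (to_ac_poly (f n)) (H x)" for x
      by (simp add: f_H) (simp add: f H_def poly_to_ac_poly_iterate)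
    moreover have "odd (frob_deg (\<beta> n))"
      by (simp add: d)
    ultimately show ?thesis
      using critical_values_square_iff[OF \<beta> _ _ frob_D _ three(1) that(2)] assms(6) three(1)
      by (simp add: deg_f d)
  qed
  have step: "Factorial_Ring.irreducible (f (Suc n)) \<longleftrightarrow> ?square n \<and> ?no_cube n"
    if irr: "Factorial_Ring.irreducible (f n)" for n
  proof -
    let ?d = "frob_deg (\<beta> n)"
    have d: "?d = 3 ^ n"
      using irr_f[OF \<beta>] irr by blast
    obtain \<delta> where \<delta>: "\<delta>\<^sup>2 = D (\<beta> n)"
      using nth_root_exists[of 2 "D (\<beta> n)"] by auto
    have root: "poly (to_ac_poly (f (Suc n))) r = 0" if "H r = \<beta> n" for r
      using \<beta>[of n] by (simp add: that flip: f_H)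
    show ?thesis
    proof (intro iffI conjI)
      assume irr': "Factorial_Ring.irreducible (f (Suc n))"
      obtain r where r: "H r = \<beta> n"
      proof -
        have "degree [:B (\<beta> n), A, 0, 1:] > 0"
          by simp
        then obtain r where "poly [:B (\<beta> n), A, 0, 1:] r = 0"
          using alg_closed_imp_poly_has_root by blast
        hence "r ^ 3 + A * r + B (\<beta> n) = 0"
          by (simp add: algebra_simps power3_eq_cube)
        thus ?thesis
          using that unfolding cubic by blast
      qed
      have "frob_deg r = 3 * ?d"
        using irr_f[OF root[OF r]] irr' d by simp
      hence cycle: "(frob ^^ ?d) r \<noteq> r" "(frob ^^ (3 * ?d)) r = r"
        using frob_deg_pos[of "\<beta> n"] by (auto simp: frob_funpow_eq_self_iff dest: dvd_imp_le)
      have r': "r ^ 3 + A * r + B (\<beta> n) = 0"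
        by (simp add: cubic r)
      note cyc = cubic_frob_cycle_imp[OF assms(7) six_ac frob_A frob_B_deg r' cycle, folded D_def]
      show "?square n"
        unfolding square_iff[OF irr \<delta>] using cyc(1) cyc(2)[OF \<delta>] by blast
      show "?no_cube n"
      proof (intro ballI impI notI, elim bexE)
        fix \<mu> c
        assume "\<mu> \<in> adjoin {\<beta> n} - {0}"
          and eq: "- 4 * to_ac (b\<^sub>1 / b\<^sub>3) ^ 3 - 27 * ((to_ac b\<^sub>0 - \<beta> n) / to_ac b\<^sub>3)\<^sup>2 = 81 * \<mu>\<^sup>2"
          and nz: "b\<^sub>1 = 0 \<longrightarrow> 1 / 2 * (- ((to_ac b\<^sub>0 - \<beta> n) / to_ac b\<^sub>3) + \<mu> * sqrt_m3) \<noteq> 0"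
          and c: "c \<in> adjoin {sqrt_m3, \<beta> n}"
            "1 / 2 * (- ((to_ac b\<^sub>0 - \<beta> n) / to_ac b\<^sub>3) + \<mu> * sqrt_m3) = c ^ 3"
        have eq: "81 * \<mu>\<^sup>2 = D (\<beta> n)"
          using eq unfolding D_def A_def B_def by (rule sym)
        have c': "1 / 2 * (- B (\<beta> n) + \<mu> * sqrt_m3) = c ^ 3"
          using c(2) unfolding B_def .
        \<comment> \<open>The exponent \<open>?d\<close> fixes \<open>\<beta> n\<close>, and
          doubling it also fixes \<surd>-3, so both generators of the field containing
          \<open>c\<close> are fixed.\<close>
        have "(frob ^^ (2 * ?d)) (\<beta> n) = \<beta> n"
          by (simp add: frob_funpow_eq_self_iff)
        hence "(frob ^^ (2 * ?d)) c = c"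
          using frob_funpow_sqrt_base[OF assms(7)] by (intro frob_fixed_adjoin[OF c(1)]) auto
        from cyc(3)[OF eq this c'] have "c = 0" .
        \<comment> \<open>If the element vanishes, then \<open>- 3 * \<mu>\<^sup>2\<close> is the
          square of \<open>B (\<beta> n)\<close>, and the discriminant equation collapses to
          \<open>4 * A ^ 3 = 0\<close>. This is the case \<open>b\<^sub>1 = 0\<close>, where the
          sign rule for \<open>\<mu>\<close> forbids a zero element.\<close>
        hence "\<mu> * sqrt_m3 = B (\<beta> n)"
          using c' two by simp
        hence "- 3 * \<mu>\<^sup>2 = (B (\<beta> n))\<^sup>2"
          using assms(7) by (metis mult.commute power_mult_distrib)
        hence "4 * A ^ 3 = 0"
          using eq unfolding D_def by Groebner_Basis.algebra
        moreover have "(4 :: 'a alg_closure) = 2 * 2"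
          by simp
        ultimately have "A = 0"
          using two by (metis mult_eq_0_iff power_eq_0_iff)
        hence "b\<^sub>1 = 0"
          using assms(6) by (simp add: A_def)
        thus False
          using nz c(2) \<open>c = 0\<close> by simp
      qed
    next
      assume hyp: "?square n \<and> ?no_cube n"
      have \<delta>': "D (\<beta> n) \<noteq> 0" "(frob ^^ ?d) \<delta> = \<delta>"
        using hyp square_iff[OF irr \<delta>] by blast+
      have "\<exists>r. r ^ 3 + A * r + B (\<beta> n) = 0 \<and> (frob ^^ ?d) r \<noteq> r \<and> (frob ^^ (3 * ?d)) r = r"
      proof (rule cubic_frob_cycle_exists[where K = "adjoin {sqrt_m3, \<beta> n}",
            OF assms(7) six_ac frob_A frob_B_deg, folded D_def, OF \<delta>'(1) \<delta> \<delta>'(2)])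
        fix a b v :: "'a alg_closure"
        assume "(frob ^^ ?d) a = a" "(frob ^^ ?d) b = b" and v: "v = sqrt_m3 \<or> v = - sqrt_m3"
        hence "a \<in> adjoin {sqrt_m3, \<beta> n}" "b \<in> adjoin {sqrt_m3, \<beta> n}"
          by (auto intro: frob_deg_fixed_in_adjoin in_adjoin)
        moreover have w: "sqrt_m3 \<in> adjoin {sqrt_m3, \<beta> n}"
          by (simp add: in_adjoin)
        have "v \<in> adjoin {sqrt_m3, \<beta> n}"
          using v adjoin_mult[OF to_ac_in_adjoin[of "- 1"] w] w by auto
        \<comment> \<open>Written with base-field constants, the resolvent is visibly a sum of
          products of elements of the generated field.\<close>
        ultimately have "(v + to_ac 3) * a * to_ac (1 / 6) + to_ac (1 / 3) * v * b \<in> adjoin {sqrt_m3, \<beta> n}"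
          by (intro adjoin_add adjoin_mult to_ac_in_adjoin)
        moreover have "(v + to_ac 3) * a * to_ac (1 / 6) + to_ac (1 / 3) * v * b
            = ((v + 3) * a + 2 * v * b) / 6"
          using six_ac three(2) by (simp add: add_divide_distrib)
        ultimately show "((v + 3) * a + 2 * v * b) / 6 \<in> adjoin {sqrt_m3, \<beta> n}"
          by (simp only:)
      next
        fix \<mu> c
        assume "(frob ^^ ?d) \<mu> = \<mu>" "\<mu> \<noteq> 0" "81 * \<mu>\<^sup>2 = D (\<beta> n)"
          "1 / 2 * (- B (\<beta> n) + \<mu> * sqrt_m3) \<noteq> 0" "c \<in> adjoin {sqrt_m3, \<beta> n}"
        \<comment> \<open>Being fixed by \<open>frob ^^ ?d\<close> places \<open>\<mu>\<close> in
          the field over which condition (2) quantifies.\<close>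
        moreover from this(1) have "\<mu> \<in> adjoin {\<beta> n}"
          by (rule frob_deg_fixed_in_adjoin) (simp add: in_adjoin)
        ultimately show "1 / 2 * (- B (\<beta> n) + \<mu> * sqrt_m3) \<noteq> c ^ 3"
          using hyp unfolding D_def A_def B_def by (metis DiffI singletonD)
      qed
      then obtain r where r: "H r = \<beta> n" "(frob ^^ ?d) r \<noteq> r" "(frob ^^ (3 * ?d)) r = r"
        unfolding cubic by blast
      have "frob_deg r = 3 * ?d"
        using r unfolding H_def by (rule frob_deg_preimage)
      thus "Factorial_Ring.irreducible (f (Suc n))"
        using irr_f[OF root[OF r(1)]] d by simp
    qed
  qed
  have irr_0: "Factorial_Ring.irreducible (f 0)"
  proof -
    \<comment> \<open>The root of the linear polynomial \<open>f 0\<close> is the base-field element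
      \<open>\<beta>\<^sub>0\<close>, of period one.\<close>
    have "(frob ^^ 1) (\<beta> 0) = \<beta> 0"
      using \<beta>[of 0] by (simp add: f frob_to_ac)
    thus ?thesis
      unfolding irr_f[OF \<beta>] frob_funpow_eq_self_iff by simp
  qed
  \<comment> \<open>The definition starts at the first iterate; including the linear
    \<open>f 0\<close> supplies the base of the induction.\<close>
  have dyn: "dynamically_irreducible h \<beta>\<^sub>0 \<longleftrightarrow> (\<forall>n. Factorial_Ring.irreducible (f n))"
    unfolding dynamically_irreducible_def f_def[symmetric] using irr_0 by (metis gr0I)
  show ?thesis
  proof
    assume "dynamically_irreducible h \<beta>\<^sub>0"
    thus "(\<forall>n. ?square n) \<and> (\<forall>n. ?no_cube n)"
      unfolding dyn using step by blast
  next
    assume hyp: "(\<forall>n. ?square n) \<and> (\<forall>n. ?no_cube n)"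
    have "Factorial_Ring.irreducible (f n)" for n
    proof (induction n)
      case (Suc n)
      show ?case
        using hyp step[OF Suc] by blast
    qed (rule irr_0)
    thus "dynamically_irreducible h \<beta>\<^sub>0"
      unfolding dyn by blast
  qed
qed

end
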